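(* Let $\mathsf{M}$ be a model category with class of weak equivalences $W$. Then the Kan homotopy category $\mathsf{Ho}_{K}(\mathsf{M})$ is a weak localization $\mathsf{M}[W^{-1}]$ of $\mathsf{M}$ at $W$. The localization functor $\mathcal{L}:\mathsf{M}\to\mathsf{Ho}_{K}(\mathsf{M})$ is defined by $\mathcal{L}X:=\tilde F\tilde C X$ on objects $X$ and by $\mathcal{L}f:=[\tilde F\tilde C f]$ on morphisms $f:X\to Y$, where $\tilde F$ is a local fibrant C-replacement and $\tilde C$ is a local cofibrant F-replacement.
   Context: All model categories are assumed to admit functorial factorizations (cofibration followed by trivial fibration, and trivial cofibration followed by fibration). The Kan homotopy category $\mathsf{Ho}_K(\mathsf{M})$ has as objects the fibrant-cofibrant objects of $\mathsf{M}$ and $\mathrm{Hom}_{\mathsf{Ho}_K(\mathsf{M})}(X,Y)=\mathrm{Hom}_{\mathsf M}(X,Y)/\simeq$, where $\simeq$ is homotopy; $[f]$ denotes the homotopy class of $f$. Local cofibrant F-replacement $\tilde C$: for every object $X$ one chooses a factorization $0\to\tilde C X\xrightarrow{c_X}X$ of the map from the initial object into a cofibration followed by a trivial fibration $c_X$, with $c_X=\mathrm{id}_X$ if $X$ is already cofibrant; for $f:X\to Y$, $\tilde C f:\tilde C X\to\tilde C Y$ is any lifting with $c_Y\circ\tilde C f=f\circ c_X$. Local fibrant C-replacement $\tilde F$: dually, for every $X$ one chooses a factorization $X\xrightarrow{f_X}\tilde F X\to *$ of the map to the terminal object into a trivial cofibration $f_X$ followed by a fibration, with $f_X=\mathrm{id}_X$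 if $X$ is already fibrant; for $f:X\to Y$, $\tilde F f:\tilde F X\to\tilde F Y$ is any lifting with $\tilde F f\circ f_X=f_Y\circ f$. Thus $\tilde F\tilde C f:\tilde F\tilde C X\to\tilde F\tilde C Y$ satisfies $\tilde F\tilde C f\circ f_{\tilde C X}=f_{\tilde C Y}\circ \tilde C f$. A weak localization of a category $\mathsf{C}$ at a family $W$ of morphisms is a category $\mathsf{C}[W^{-1}]$ with a functor $L:\mathsf{C}\to\mathsf{C}[W^{-1}]$ sending morphisms in $W$ to isomorphisms such that: (L1) for every category $\mathsf{D}$ and functor $F:\mathsf{C}\to\mathsf{D}$ sending morphisms in $W$ to isomorphisms there are a functor $\bar F:\mathsf{C}[W^{-1}]\to\mathsf{D}$ and a natural isomorphism $\eta:F\Rightarrow\bar F\circ L$; (L2') for every category $\mathsf{D}$ the functor $-\circ L:\mathrm{Fun}(\mathsf{C}[W^{-1}],\mathsf{D})\to\mathrm{Fun}(\mathsf{C},\mathsf{D})$ is fully faithful. *)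

theory Defs
  imports "HOL-Library.FuncSet"
begin

section \<open>Categories, functors and natural transformations\<close>

record ('o, 'm) category =
  Obj :: "'o set"
  Arr :: "'m set"
  Dom :: "'m \<Rightarrow> 'o"
  Cod :: "'m \<Rightarrow> 'o"
  Idn :: "'o \<Rightarrow> 'm"
  Cmp :: "'m \<Rightarrow> 'm \<Rightarrow> 'm"  (infixl "\<cdot>\<index>" 70)

definition hom :: "('o, 'm, 'z) category_scheme \<Rightarrow> 'o \<Rightarrow> 'o \<Rightarrow> 'm set" where
  "hom C x y = {f \<in> Arr C. Dom C f = x \<and> Cod C f = y}"

locale category =
  fixes C :: "('o, 'm, 'z) category_scheme" (structure)
  assumes dom_obj: "f \<in> Arr C \<Longrightarrow> Dom C f \<in> Obj C"
    and cod_obj: "f \<in> Arr C \<Longrightarrow> Cod C f \<in> Obj C"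
    and idn_hom: "x \<in> Obj C \<Longrightarrow> Idn C x \<in> hom C x x"
    and cmp_hom: "f \<in> hom C x y \<Longrightarrow> g \<in> hom C y z \<Longrightarrow> g \<cdot> f \<in> hom C x z"
    and cmp_idn_left: "f \<in> hom C x y \<Longrightarrow> Idn C y \<cdot> f = f"
    and cmp_idn_right: "f \<in> hom C x y \<Longrightarrow> f \<cdot> Idn C x = f"
    and cmp_assoc: "f \<in> hom C w x \<Longrightarrow> g \<in> hom C x y \<Longrightarrow> h \<in> hom C y z \<Longrightarrow>
      h \<cdot> g \<cdot> f = h \<cdot> (g \<cdot> f)"

definition is_iso :: "('o, 'm, 'z) category_scheme \<Rightarrow> 'm \<Rightarrow> bool" where
  "is_iso C f \<longleftrightarrow> f \<in> Arr C \<and>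
    (\<exists>g \<in> hom C (Cod C f) (Dom C f).
      g \<cdot>\<^bsub>C\<^esub> f = Idn C (Dom C f) \<and> f \<cdot>\<^bsub>C\<^esub> g = Idn C (Cod C f))"

definition is_retract :: "('o, 'm, 'z) category_scheme \<Rightarrow> 'o \<Rightarrow> 'o \<Rightarrow> bool" where
  "is_retract C x y \<longleftrightarrow>
    (\<exists>i \<in> hom C x y. \<exists>r \<in> hom C y x. r \<cdot>\<^bsub>C\<^esub> i = Idn C x)"

record ('o, 'm, 'p, 'n) cat_map =
  ObjMap :: "'o \<Rightarrow> 'p"
  ArrMap :: "'m \<Rightarrow> 'n"

locale cat_functor = A: category A + B: category B
  for A :: "('o, 'm, 'y) category_scheme"
    and B :: "('p, 'n, 'z) category_scheme" +
  fixes F :: "('o, 'm, 'p, 'n) cat_map"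
  assumes obj_map: "x \<in> Obj A \<Longrightarrow> ObjMap F x \<in> Obj B"
    and arr_map: "f \<in> hom A x y \<Longrightarrow> ArrMap F f \<in> hom B (ObjMap F x) (ObjMap F y)"
    and map_idn: "x \<in> Obj A \<Longrightarrow> ArrMap F (Idn A x) = Idn B (ObjMap F x)"
    and map_cmp: "f \<in> hom A x y \<Longrightarrow> g \<in> hom A y z \<Longrightarrow>
      ArrMap F (g \<cdot>\<^bsub>A\<^esub> f) = ArrMap F g \<cdot>\<^bsub>B\<^esub> ArrMap F f"

definition fully_faithful ::
  "('o, 'm, 'y) category_scheme \<Rightarrow> ('p, 'n, 'z) category_scheme \<Rightarrow>
    ('o, 'm, 'p, 'n) cat_map \<Rightarrow> bool" where
  "fully_faithful A B F \<longleftrightarrow> cat_functor A B F \<and>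
    (\<forall>x \<in> Obj A. \<forall>y \<in> Obj A.
      bij_betw (ArrMap F) (hom A x y) (hom B (ObjMap F x) (ObjMap F y)))"

definition cat_comp ::
  "('o, 'm, 'z) category_scheme \<Rightarrow> ('p, 'n, 'q, 'k) cat_map \<Rightarrow> ('o, 'm, 'p, 'n) cat_map \<Rightarrow>
    ('o, 'm, 'q, 'k) cat_map" where
  "cat_comp A G F =
    \<lparr>ObjMap = compose (Obj A) (ObjMap G) (ObjMap F),
     ArrMap = compose (Arr A) (ArrMap G) (ArrMap F)\<rparr>"

definition nat_trans ::
  "('o, 'm, 'y) category_scheme \<Rightarrow> ('p, 'n, 'z) category_scheme \<Rightarrow>
    ('o, 'm, 'p, 'n) cat_map \<Rightarrow> ('o, 'm, 'p, 'n) cat_map \<Rightarrow> ('o \<Rightarrow> 'n) \<Rightarrow> bool" where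
  "nat_trans A B F G t \<longleftrightarrow> cat_functor A B F \<and> cat_functor A B G \<and>
    (\<forall>x \<in> Obj A. t x \<in> hom B (ObjMap F x) (ObjMap G x)) \<and>
    (\<forall>f \<in> Arr A. t (Cod A f) \<cdot>\<^bsub>B\<^esub> ArrMap F f = ArrMap G f \<cdot>\<^bsub>B\<^esub> t (Dom A f))"

definition nat_iso ::
  "('o, 'm, 'y) category_scheme \<Rightarrow> ('p, 'n, 'z) category_scheme \<Rightarrow>
    ('o, 'm, 'p, 'n) cat_map \<Rightarrow> ('o, 'm, 'p, 'n) cat_map \<Rightarrow> ('o \<Rightarrow> 'n) \<Rightarrow> bool" where
  "nat_iso A B F G t \<longleftrightarrow> nat_trans A B F G t \<and> (\<forall>x \<in> Obj A. is_iso B (t x))"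

text \<open>In the functor category, functors and natural transformations are represented by
  extensional functions, so that equality in HOL is equality on the objects and arrows
  of the source category.\<close>

definition functor_category ::
  "('o, 'm, 'y) category_scheme \<Rightarrow> ('p, 'n, 'z) category_scheme \<Rightarrow>
    (('o, 'm, 'p, 'n) cat_map,
     ('o, 'm, 'p, 'n) cat_map \<times> ('o, 'm, 'p, 'n) cat_map \<times> ('o \<Rightarrow> 'n)) category" where
  "functor_category A B =
    (let Fun = {F. cat_functor A B F \<and>
                   ObjMap F \<in> extensional (Obj A) \<and> ArrMap F \<in> extensional (Arr A)} in
    \<lparr>Obj = Fun,
     Arr = {(F, G, t). F \<in> Fun \<and> G \<in> Fun \<and> nat_trans A B F G t \<and> t \<in> extensional (Obj A)},
     Dom = (\<lambda>(F, G, t). F),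
     Cod = (\<lambda>(F, G, t). G),
     Idn = (\<lambda>F. (F, F, \<lambda>x \<in> Obj A. Idn B (ObjMap F x))),
     Cmp = (\<lambda>(F', G', t') (F, G, t). (F, G', \<lambda>x \<in> Obj A. t' x \<cdot>\<^bsub>B\<^esub> t x))\<rparr>)"

text \<open>Precomposition with \<open>L\<close>, from functors on the target \<open>H\<close> of \<open>L\<close> to functors on its
  source \<open>C\<close>.\<close>

definition precomposition ::
  "('o, 'm, 'y) category_scheme \<Rightarrow> ('o, 'm, 'p, 'n) cat_map \<Rightarrow>
    (('p, 'n, 'q, 'k) cat_map,
     ('p, 'n, 'q, 'k) cat_map \<times> ('p, 'n, 'q, 'k) cat_map \<times> ('p \<Rightarrow> 'k),
     ('o, 'm, 'q, 'k) cat_map,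
     ('o, 'm, 'q, 'k) cat_map \<times> ('o, 'm, 'q, 'k) cat_map \<times> ('o \<Rightarrow> 'k)) cat_map" where
  "precomposition C L =
    \<lparr>ObjMap = (\<lambda>G. cat_comp C G L),
     ArrMap = (\<lambda>(G, G', t).
       (cat_comp C G L, cat_comp C G' L, compose (Obj C) t (ObjMap L)))\<rparr>"


section \<open>Weak localizations\<close>

definition inverts ::
  "('o, 'm, 'y) category_scheme \<Rightarrow> ('p, 'n, 'z) category_scheme \<Rightarrow> 'm set \<Rightarrow>
    ('o, 'm, 'p, 'n) cat_map \<Rightarrow> bool" where
  "inverts C D W F \<longleftrightarrow> cat_functor C D F \<and> (\<forall>w \<in> W. is_iso D (ArrMap F w))"

text \<open>HOL has no quantification over types inside a formula. The test categories \<open>D\<close> below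
  therefore range over all categories with objects in \<open>'q\<close> and arrows in \<open>'k\<close>, the first
  argument naming these two types. A statement about \<open>weak_localization TYPE('q \<times> 'k)\<close> in which
  \<open>'q\<close> and \<open>'k\<close> are free type variables is a statement about all categories \<open>D\<close>.\<close>

definition weak_localization ::
  "('q \<times> 'k) itself \<Rightarrow> ('o, 'm, 'y) category_scheme \<Rightarrow> 'm set \<Rightarrow>
    ('p, 'n, 'z) category_scheme \<Rightarrow> ('o, 'm, 'p, 'n) cat_map \<Rightarrow> bool" where
  "weak_localization T C W H L \<longleftrightarrow>
    inverts C H W L \<and>
    (\<forall>(D :: ('q, 'k) category) F. category D \<longrightarrow> inverts C D W F \<longrightarrow>
      (\<exists>F' \<eta>. cat_functor H D F' \<and> nat_iso C D F (cat_comp C F' L) \<eta>)) \<and>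
    (\<forall>D :: ('q, 'k) category. category D \<longrightarrow>
      fully_faithful (functor_category H D) (functor_category C D) (precomposition C L))"


section \<open>Finite limits and colimits\<close>

definition is_cone ::
  "('j, 'a, 'y) category_scheme \<Rightarrow> ('o, 'm, 'z) category_scheme \<Rightarrow> ('j, 'a, 'o, 'm) cat_map \<Rightarrow>
    'o \<Rightarrow> ('j \<Rightarrow> 'm) \<Rightarrow> bool" where
  "is_cone J C D x l \<longleftrightarrow> x \<in> Obj C \<and>
    (\<forall>j \<in> Obj J. l j \<in> hom C x (ObjMap D j)) \<and>
    (\<forall>a \<in> Arr J. ArrMap D a \<cdot>\<^bsub>C\<^esub> l (Dom J a) = l (Cod J a))"

definition is_limit ::
  "('j, 'a, 'y) category_scheme \<Rightarrow> ('o, 'm, 'z) category_scheme \<Rightarrow> ('j, 'a, 'o, 'm) cat_map \<Rightarrow>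
    'o \<Rightarrow> ('j \<Rightarrow> 'm) \<Rightarrow> bool" where
  "is_limit J C D x l \<longleftrightarrow> is_cone J C D x l \<and>
    (\<forall>y k. is_cone J C D y k \<longrightarrow>
      (\<exists>!u. u \<in> hom C y x \<and> (\<forall>j \<in> Obj J. l j \<cdot>\<^bsub>C\<^esub> u = k j)))"

definition is_cocone ::
  "('j, 'a, 'y) category_scheme \<Rightarrow> ('o, 'm, 'z) category_scheme \<Rightarrow> ('j, 'a, 'o, 'm) cat_map \<Rightarrow>
    'o \<Rightarrow> ('j \<Rightarrow> 'm) \<Rightarrow> bool" where
  "is_cocone J C D x l \<longleftrightarrow> x \<in> Obj C \<and>
    (\<forall>j \<in> Obj J. l j \<in> hom C (ObjMap D j) x) \<and>
    (\<forall>a \<in> Arr J. l (Cod J a) \<cdot>\<^bsub>C\<^esub> ArrMap D a = l (Dom J a))"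

definition is_colimit ::
  "('j, 'a, 'y) category_scheme \<Rightarrow> ('o, 'm, 'z) category_scheme \<Rightarrow> ('j, 'a, 'o, 'm) cat_map \<Rightarrow>
    'o \<Rightarrow> ('j \<Rightarrow> 'm) \<Rightarrow> bool" where
  "is_colimit J C D x l \<longleftrightarrow> is_cocone J C D x l \<and>
    (\<forall>y k. is_cocone J C D y k \<longrightarrow>
      (\<exists>!u. u \<in> hom C x y \<and> (\<forall>j \<in> Obj J. u \<cdot>\<^bsub>C\<^esub> l j = k j)))"

text \<open>Every finite category is isomorphic to one whose objects and arrows are natural numbers.\<close>

definition has_finite_limits :: "('o, 'm, 'z) category_scheme \<Rightarrow> bool" where
  "has_finite_limits C \<longleftrightarrow>
    (\<forall>(J :: (nat, nat) category) D. finite (Obj J) \<longrightarrow> finite (Arr J) \<longrightarrow> cat_functor J C D \<longrightarrow>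
      (\<exists>x l. is_limit J C D x l))"

definition has_finite_colimits :: "('o, 'm, 'z) category_scheme \<Rightarrow> bool" where
  "has_finite_colimits C \<longleftrightarrow>
    (\<forall>(J :: (nat, nat) category) D. finite (Obj J) \<longrightarrow> finite (Arr J) \<longrightarrow> cat_functor J C D \<longrightarrow>
      (\<exists>x l. is_colimit J C D x l))"

definition is_initial :: "('o, 'm, 'z) category_scheme \<Rightarrow> 'o \<Rightarrow> bool" where
  "is_initial C x \<longleftrightarrow> x \<in> Obj C \<and> (\<forall>y \<in> Obj C. \<exists>!f. f \<in> hom C x y)"

definition is_terminal :: "('o, 'm, 'z) category_scheme \<Rightarrow> 'o \<Rightarrow> bool" where
  "is_terminal C x \<longleftrightarrow> x \<in> Obj C \<and> (\<forall>y \<in> Obj C. \<exists>!f. f \<in> hom C y x)"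

definition is_coproduct ::
  "('o, 'm, 'z) category_scheme \<Rightarrow> 'o \<Rightarrow> 'o \<Rightarrow> 'o \<Rightarrow> 'm \<Rightarrow> 'm \<Rightarrow> bool" where
  "is_coproduct C x y s i j \<longleftrightarrow> i \<in> hom C x s \<and> j \<in> hom C y s \<and>
    (\<forall>z. \<forall>f \<in> hom C x z. \<forall>g \<in> hom C y z.
      \<exists>!u. u \<in> hom C s z \<and> u \<cdot>\<^bsub>C\<^esub> i = f \<and> u \<cdot>\<^bsub>C\<^esub> j = g)"

definition is_product ::
  "('o, 'm, 'z) category_scheme \<Rightarrow> 'o \<Rightarrow> 'o \<Rightarrow> 'o \<Rightarrow> 'm \<Rightarrow> 'm \<Rightarrow> bool" where
  "is_product C x y s p q \<longleftrightarrow> p \<in> hom C s x \<and> q \<in> hom C s y \<and>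
    (\<forall>z. \<forall>f \<in> hom C z x. \<forall>g \<in> hom C z y.
      \<exists>!u. u \<in> hom C z s \<and> p \<cdot>\<^bsub>C\<^esub> u = f \<and> q \<cdot>\<^bsub>C\<^esub> u = g)"


section \<open>Model categories\<close>

text \<open>An arrow \<open>(f, u, v, g)\<close> of the arrow category is the commutative square
  \<open>g \<cdot> u = v \<cdot> f\<close> regarded as an arrow from \<open>f\<close> to \<open>g\<close>.\<close>

definition arrow_category ::
  "('o, 'm, 'z) category_scheme \<Rightarrow> ('m, 'm \<times> 'm \<times> 'm \<times> 'm) category" where
  "arrow_category C =
    \<lparr>Obj = Arr C,
     Arr = {(f, u, v, g). f \<in> Arr C \<and> g \<in> Arr C \<and>
              u \<in> hom C (Dom C f) (Dom C g) \<and> v \<in> hom C (Cod C f) (Cod C g) \<and>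
              g \<cdot>\<^bsub>C\<^esub> u = v \<cdot>\<^bsub>C\<^esub> f},
     Dom = (\<lambda>(f, u, v, g). f),
     Cod = (\<lambda>(f, u, v, g). g),
     Idn = (\<lambda>f. (f, Idn C (Dom C f), Idn C (Cod C f), f)),
     Cmp = (\<lambda>(f', u', v', g') (f, u, v, g). (f, u' \<cdot>\<^bsub>C\<^esub> u, v' \<cdot>\<^bsub>C\<^esub> v, g'))\<rparr>"

definition dom_functor ::
  "('o, 'm, 'z) category_scheme \<Rightarrow> ('m, 'm \<times> 'm \<times> 'm \<times> 'm, 'o, 'm) cat_map" where
  "dom_functor C = \<lparr>ObjMap = Dom C, ArrMap = (\<lambda>(f, u, v, g). u)\<rparr>"

definition cod_functor ::
  "('o, 'm, 'z) category_scheme \<Rightarrow> ('m, 'm \<times> 'm \<times> 'm \<times> 'm, 'o, 'm) cat_map" where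
  "cod_functor C = \<lparr>ObjMap = Cod C, ArrMap = (\<lambda>(f, u, v, g). v)\<rparr>"

text \<open>Functorial factorization of every arrow \<open>f\<close> as \<open>b f \<cdot> a f\<close> with \<open>a f\<close> in \<open>L\<close>, \<open>b f\<close> in
  \<open>R\<close> and middle object \<open>ObjMap E f\<close>.\<close>

definition has_functorial_factorization ::
  "('o, 'm, 'z) category_scheme \<Rightarrow> 'm set \<Rightarrow> 'm set \<Rightarrow> bool" where
  "has_functorial_factorization C L R \<longleftrightarrow>
    (\<exists>E a b. nat_trans (arrow_category C) C (dom_functor C) E a \<and>
             nat_trans (arrow_category C) C E (cod_functor C) b \<and>
             (\<forall>f \<in> Arr C. a f \<in> L \<and> b f \<in> R \<and> b f \<cdot>\<^bsub>C\<^esub> a f = f))"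

definition has_lifting :: "('o, 'm, 'z) category_scheme \<Rightarrow> 'm \<Rightarrow> 'm \<Rightarrow> bool" where
  "has_lifting C i p \<longleftrightarrow>
    (\<forall>u \<in> hom C (Dom C i) (Dom C p). \<forall>v \<in> hom C (Cod C i) (Cod C p).
      p \<cdot>\<^bsub>C\<^esub> u = v \<cdot>\<^bsub>C\<^esub> i \<longrightarrow>
      (\<exists>h \<in> hom C (Cod C i) (Dom C p). h \<cdot>\<^bsub>C\<^esub> i = u \<and> p \<cdot>\<^bsub>C\<^esub> h = v))"

definition retract_closed :: "('o, 'm, 'z) category_scheme \<Rightarrow> 'm set \<Rightarrow> bool" where
  "retract_closed C S \<longleftrightarrow>
    (\<forall>f g. g \<in> S \<longrightarrow> is_retract (arrow_category C) f g \<longrightarrow> f \<in> S)"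

record ('o, 'm) model_structure = "('o, 'm) category" +
  WEq :: "'m set"
  Cofib :: "'m set"
  Fibr :: "'m set"

text \<open>Quillen's axioms for a closed model category (only finite limits and colimits are
  required), with functorial factorizations.\<close>

locale model_category = category M
  for M :: "('o, 'm, 'z) model_structure_scheme" (structure) +
  assumes weq_arr: "WEq M \<subseteq> Arr M"
    and cofib_arr: "Cofib M \<subseteq> Arr M"
    and fibr_arr: "Fibr M \<subseteq> Arr M"
    and finite_limits: "has_finite_limits M"
    and finite_colimits: "has_finite_colimits M"
    and weq_cmp: "f \<in> hom M x y \<Longrightarrow> g \<in> hom M y z \<Longrightarrow> f \<in> WEq M \<Longrightarrow> g \<in> WEq M \<Longrightarrow>
      g \<cdot> f \<in> WEq M"
    and weq_cancel_left: "f \<in> hom M x y \<Longrightarrow> g \<in> hom M y z \<Longrightarrow> g \<in> WEq M \<Longrightarrow> g \<cdot> f \<in> WEq M \<Longrightarrow>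
      f \<in> WEq M"
    and weq_cancel_right: "f \<in> hom M x y \<Longrightarrow> g \<in> hom M y z \<Longrightarrow> f \<in> WEq M \<Longrightarrow> g \<cdot> f \<in> WEq M \<Longrightarrow>
      g \<in> WEq M"
    and weq_retract: "retract_closed M (WEq M)"
    and cofib_retract: "retract_closed M (Cofib M)"
    and fibr_retract: "retract_closed M (Fibr M)"
    and lift_cofib: "i \<in> Cofib M \<Longrightarrow> p \<in> Fibr M \<inter> WEq M \<Longrightarrow> has_lifting M i p"
    and lift_fibr: "i \<in> Cofib M \<inter> WEq M \<Longrightarrow> p \<in> Fibr M \<Longrightarrow> has_lifting M i p"
    and factor_cofib: "has_functorial_factorization M (Cofib M) (Fibr M \<inter> WEq M)"
    and factor_fibr: "has_functorial_factorization M (Cofib M \<inter> WEq M) (Fibr M)"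

definition cofibrant :: "('o, 'm, 'z) model_structure_scheme \<Rightarrow> 'o \<Rightarrow> bool" where
  "cofibrant M x \<longleftrightarrow> x \<in> Obj M \<and> (\<exists>z. is_initial M z \<and> (\<exists>i \<in> hom M z x. i \<in> Cofib M))"

definition fibrant :: "('o, 'm, 'z) model_structure_scheme \<Rightarrow> 'o \<Rightarrow> bool" where
  "fibrant M x \<longleftrightarrow> x \<in> Obj M \<and> (\<exists>z. is_terminal M z \<and> (\<exists>p \<in> hom M x z. p \<in> Fibr M))"


section \<open>Homotopy and the Kan homotopy category\<close>

text \<open>A cylinder object \<open>c\<close> of \<open>x\<close>, given by the end inclusions \<open>i0\<close>, \<open>i1\<close> and the projection
  \<open>s\<close>: the fold map of a coproduct \<open>p\<close> of \<open>x\<close> with itself factors as a cofibration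
  \<open>k = [i0, i1]\<close> to \<open>c\<close>, followed by the weak equivalence \<open>s\<close>.\<close>

definition is_cylinder ::
  "('o, 'm, 'z) model_structure_scheme \<Rightarrow> 'o \<Rightarrow> 'o \<Rightarrow> 'm \<Rightarrow> 'm \<Rightarrow> 'm \<Rightarrow> bool" where
  "is_cylinder M x c i0 i1 s \<longleftrightarrow>
    (\<exists>p j0 j1 k. is_coproduct M x x p j0 j1 \<and> k \<in> hom M p c \<and> k \<in> Cofib M \<and>
       i0 = k \<cdot>\<^bsub>M\<^esub> j0 \<and> i1 = k \<cdot>\<^bsub>M\<^esub> j1) \<and>
    s \<in> hom M c x \<and> s \<in> WEq M \<and> s \<cdot>\<^bsub>M\<^esub> i0 = Idn M x \<and> s \<cdot>\<^bsub>M\<^esub> i1 = Idn M x"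

definition is_path_object ::
  "('o, 'm, 'z) model_structure_scheme \<Rightarrow> 'o \<Rightarrow> 'o \<Rightarrow> 'm \<Rightarrow> 'm \<Rightarrow> 'm \<Rightarrow> bool" where
  "is_path_object M y c p0 p1 s \<longleftrightarrow>
    (\<exists>p q0 q1 k. is_product M y y p q0 q1 \<and> k \<in> hom M c p \<and> k \<in> Fibr M \<and>
       p0 = q0 \<cdot>\<^bsub>M\<^esub> k \<and> p1 = q1 \<cdot>\<^bsub>M\<^esub> k) \<and>
    s \<in> hom M y c \<and> s \<in> WEq M \<and> p0 \<cdot>\<^bsub>M\<^esub> s = Idn M y \<and> p1 \<cdot>\<^bsub>M\<^esub> s = Idn M y"

definition left_homotopic ::
  "('o, 'm, 'z) model_structure_scheme \<Rightarrow> 'm \<Rightarrow> 'm \<Rightarrow> bool" where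
  "left_homotopic M f g \<longleftrightarrow> f \<in> Arr M \<and> g \<in> hom M (Dom M f) (Cod M f) \<and>
    (\<exists>c i0 i1 s. is_cylinder M (Dom M f) c i0 i1 s \<and>
      (\<exists>h \<in> hom M c (Cod M f). h \<cdot>\<^bsub>M\<^esub> i0 = f \<and> h \<cdot>\<^bsub>M\<^esub> i1 = g))"

definition right_homotopic ::
  "('o, 'm, 'z) model_structure_scheme \<Rightarrow> 'm \<Rightarrow> 'm \<Rightarrow> bool" where
  "right_homotopic M f g \<longleftrightarrow> f \<in> Arr M \<and> g \<in> hom M (Dom M f) (Cod M f) \<and>
    (\<exists>c p0 p1 s. is_path_object M (Cod M f) c p0 p1 s \<and>
      (\<exists>h \<in> hom M (Dom M f) c. p0 \<cdot>\<^bsub>M\<^esub> h = f \<and> p1 \<cdot>\<^bsub>M\<^esub> h = g))"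

definition homotopic :: "('o, 'm, 'z) model_structure_scheme \<Rightarrow> 'm \<Rightarrow> 'm \<Rightarrow> bool" where
  "homotopic M f g \<longleftrightarrow> left_homotopic M f g \<and> right_homotopic M f g"

definition homotopy_class :: "('o, 'm, 'z) model_structure_scheme \<Rightarrow> 'm \<Rightarrow> 'm set" where
  "homotopy_class M f = {g. homotopic M f g}"

text \<open>All members of a homotopy class are parallel, so the choice of a representative does not
  affect domain and codomain. The composite of two classes consists of all arrows homotopic to
  a composite of representatives.\<close>

definition kan_homotopy_category ::
  "('o, 'm, 'z) model_structure_scheme \<Rightarrow> ('o, 'm set) category" where
  "kan_homotopy_category M =
    (let FC = {x \<in> Obj M. fibrant M x \<and> cofibrant M x} in
    \<lparr>Obj = FC,
     Arr = (\<Union>x \<in> FC. \<Union>y \<in> FC. homotopy_class M ` hom M x y),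
     Dom = (\<lambda>K. Dom M (SOME f. f \<in> K)),
     Cod = (\<lambda>K. Cod M (SOME f. f \<in> K)),
     Idn = (\<lambda>x. homotopy_class M (Idn M x)),
     Cmp = (\<lambda>K' K. \<Union>g \<in> K'. \<Union>f \<in> K. homotopy_class M (g \<cdot>\<^bsub>M\<^esub> f))\<rparr>)"


section \<open>Local replacements and the localization functor\<close>

text \<open>\<open>RepObj\<close> and \<open>RepArr\<close> are the values of the replacement on objects and arrows, and
  \<open>RepMap x\<close> is the comparison arrow between \<open>x\<close> and its replacement. Neither replacement is
  required to be functorial.\<close>

record ('o, 'm) replacement =
  RepObj :: "'o \<Rightarrow> 'o"
  RepMap :: "'o \<Rightarrow> 'm"
  RepArr :: "'m \<Rightarrow> 'm"

definition local_cofibrant_replacement ::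
  "('o, 'm, 'z) model_structure_scheme \<Rightarrow> ('o, 'm) replacement \<Rightarrow> bool" where
  "local_cofibrant_replacement M R \<longleftrightarrow>
    (\<forall>x \<in> Obj M. cofibrant M (RepObj R x) \<and>
       RepMap R x \<in> hom M (RepObj R x) x \<and> RepMap R x \<in> Fibr M \<inter> WEq M \<and>
       (cofibrant M x \<longrightarrow> RepObj R x = x \<and> RepMap R x = Idn M x)) \<and>
    (\<forall>x y. \<forall>f \<in> hom M x y.
       RepArr R f \<in> hom M (RepObj R x) (RepObj R y) \<and>
       RepMap R y \<cdot>\<^bsub>M\<^esub> RepArr R f = f \<cdot>\<^bsub>M\<^esub> RepMap R x)"

definition local_fibrant_replacement ::
  "('o, 'm, 'z) model_structure_scheme \<Rightarrow> ('o, 'm) replacement \<Rightarrow> bool" where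
  "local_fibrant_replacement M R \<longleftrightarrow>
    (\<forall>x \<in> Obj M. fibrant M (RepObj R x) \<and>
       RepMap R x \<in> hom M x (RepObj R x) \<and> RepMap R x \<in> Cofib M \<inter> WEq M \<and>
       (fibrant M x \<longrightarrow> RepObj R x = x \<and> RepMap R x = Idn M x)) \<and>
    (\<forall>x y. \<forall>f \<in> hom M x y.
       RepArr R f \<in> hom M (RepObj R x) (RepObj R y) \<and>
       RepArr R f \<cdot>\<^bsub>M\<^esub> RepMap R x = RepMap R y \<cdot>\<^bsub>M\<^esub> f)"

definition localization_functor ::
  "('o, 'm, 'z) model_structure_scheme \<Rightarrow> ('o, 'm) replacement \<Rightarrow> ('o, 'm) replacement \<Rightarrow>
    ('o, 'm, 'o, 'm set) cat_map" where
  "localization_functor M Ft Ct =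
    \<lparr>ObjMap = (\<lambda>x. RepObj Ft (RepObj Ct x)),
     ArrMap = (\<lambda>f. homotopy_class M (RepArr Ft (RepArr Ct f)))\<rparr>"

end

theory Submission
  imports Defs
begin

text \<open>Write \<open>CX\<close> for the cofibrant replacement of \<open>X\<close>, with its trivial
  fibration \<open>c : CX \<rightarrow> X\<close>, and \<open>FCX\<close> for the fibrant replacement of \<open>CX\<close>, with its trivial
  cofibration \<open>j : CX \<rightarrow> FCX\<close>. Everything rests on the zigzag \<open>X \<leftarrow> CX \<rightarrow> FCX\<close> of weak equivalences
  and on two facts about lifts: a trivial fibration is monic up to left homotopy, and a trivial
  cofibration is epic up to right homotopy
  (\<open>trivial_fibration_monic_up_to_homotopy\<close>, \<open>trivial_cofibration_epic_up_to_homotopy\<close>). Between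
  a cofibrant source and a fibrant target the two homotopy relations coincide and form a
  congruence.

  Call \<open>h : FCX \<rightarrow> FCY\<close> a bifibrant lift of \<open>f : X \<rightarrow> Y\<close> if it is connected to \<open>f\<close> by a commutative
  ladder over the two zigzags. Any two bifibrant lifts of \<open>f\<close> are homotopic
  (\<open>bifibrant_lift_unique\<close>). This single uniqueness statement gives the functoriality of the
  localization functor \<open>L\<close>, because identities and composites of bifibrant lifts are bifibrant
  lifts; it also gives \<open>L c = L j = id\<close> and \<open>L f = [f]\<close> for \<open>f\<close> between fibrant-cofibrant objects.
  That \<open>L\<close> inverts weak equivalences is Whitehead's theorem (\<open>weq_is_iso_kan\<close>): a weak
  equivalence between fibrant-cofibrant objects factors into a trivial cofibration and a trivial
  fibration through a fibrant-cofibrant object, and both have homotopy inverses.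

  A functor \<open>G\<close> that inverts weak equivalences identifies homotopic arrows, since it inverts the
  projection of a cylinder and hence identifies the two ends. So \<open>G\<close> descends to the Kan homotopy
  category, and \<open>G(j) G(c)\<^sup>-\<^sup>1\<close> is the comparison with the original functor
  (\<open>localization_functor_universal\<close>). Precomposition with \<open>L\<close> is fully faithful because \<open>L\<close> fixes
  the fibrant-cofibrant objects, is full on them and sends both legs of the zigzag to identities:
  a transformation is then determined by, and extends from, its components at
  fibrant-cofibrant objects (\<open>precomposition_fully_faithful\<close>).

  The axioms of a model category are self-dual. The homotopy theory is therefore developed over a
  self-dual list of consequences of the axioms, and the statements about path objects, right
  homotopies and fibrant objects are obtained from those about cylinders, left homotopies and
  cofibrant objects in the opposite category.\<close>

section \<open>Categories, isomorphisms and functors\<close>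

context category
begin

lemma hom_obj: "f \<in> hom C x y \<Longrightarrow> x \<in> Obj C" "f \<in> hom C x y \<Longrightarrow> y \<in> Obj C"
  using dom_obj cod_obj by (auto simp: hom_def)

lemma hom_arr: "f \<in> hom C x y \<Longrightarrow> f \<in> Arr C"
  by (simp add: hom_def)

lemma arr_hom: "f \<in> Arr C \<Longrightarrow> f \<in> hom C (Dom C f) (Cod C f)"
  by (simp add: hom_def)

lemma is_isoI:
  assumes "f \<in> hom C x y" "g \<in> hom C y x" "g \<cdot> f = Idn C x" "f \<cdot> g = Idn C y"
  shows "is_iso C f"
  using assms by (auto simp: is_iso_def hom_def)

lemma is_isoE:
  assumes "is_iso C f" "f \<in> hom C x y"
  obtains g where "g \<in> hom C y x" "g \<cdot> f = Idn C x" "f \<cdot> g = Idn C y"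
  using assms by (auto simp: is_iso_def hom_def)

lemma is_iso_cmp:
  assumes f: "f \<in> hom C x y" "is_iso C f" and g: "g \<in> hom C y z" "is_iso C g"
  shows "is_iso C (g \<cdot> f)"
proof -
  obtain f' where f': "f' \<in> hom C y x" "f' \<cdot> f = Idn C x" "f \<cdot> f' = Idn C y"
    using f by (rule_tac is_isoE)
  obtain g' where g': "g' \<in> hom C z y" "g' \<cdot> g = Idn C y" "g \<cdot> g' = Idn C z"
    using g by (rule_tac is_isoE)
  have "f' \<cdot> g' \<cdot> (g \<cdot> f) = f' \<cdot> (g' \<cdot> g \<cdot> f)"
    using cmp_assoc[OF cmp_hom[OF f(1) g(1)] g'(1) f'(1)] cmp_assoc[OF f(1) g(1) g'(1)] by simp
  moreover have "g \<cdot> f \<cdot> (f' \<cdot> g') = g \<cdot> (f \<cdot> f' \<cdot> g')"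
    using cmp_assoc[OF cmp_hom[OF g'(1) f'(1)] f(1) g(1)] cmp_assoc[OF g'(1) f'(1) f(1)] by simp
  ultimately show ?thesis
    using f(1) f' g(1) g' by (intro is_isoI[of _ x z "f' \<cdot> g'"]) (auto intro: cmp_hom simp: cmp_idn_left)
qed

lemma iso_cancel_left:
  assumes "is_iso C g" "g \<in> hom C y z" "f \<in> hom C x y" "f' \<in> hom C x y" "g \<cdot> f = g \<cdot> f'"
  shows "f = f'"
proof -
  obtain h where h: "h \<in> hom C z y" "h \<cdot> g = Idn C y" by (rule is_isoE[OF assms(1,2)])
  then show ?thesis
    using cmp_assoc[OF assms(3,2) h(1)] cmp_assoc[OF assms(4,2) h(1)] assms(3-5)
    by (simp add: cmp_idn_left)
qed

end

lemma cat_functor_cat_comp: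
  assumes "cat_functor A B F" "cat_functor B C G"
  shows "cat_functor A C (cat_comp A G F)"
proof -
  interpret F: cat_functor A B F by fact
  interpret G: cat_functor B C G by fact
  have eq: "ArrMap (cat_comp A G F) f = ArrMap G (ArrMap F f)" if "f \<in> hom A x y" for f x y
    using that by (simp add: cat_comp_def compose_def hom_def)
  have eqo: "ObjMap (cat_comp A G F) x = ObjMap G (ObjMap F x)" if "x \<in> Obj A" for x
    using that by (simp add: cat_comp_def compose_def)
  show ?thesis
  proof
    fix x assume "x \<in> Obj A"
    then show "ObjMap (cat_comp A G F) x \<in> Obj C"
      by (simp add: eqo F.obj_map G.obj_map)
  next
    fix f x y assume f: "f \<in> hom A x y"
    then have "x \<in> Obj A" "y \<in> Obj A" by (simp_all add: F.A.hom_obj)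
    then show "ArrMap (cat_comp A G F) f \<in> hom C (ObjMap (cat_comp A G F) x) (ObjMap (cat_comp A G F) y)"
      using eq[OF f] eqo F.arr_map[OF f] G.arr_map by simp
  next
    fix x assume x: "x \<in> Obj A"
    show "ArrMap (cat_comp A G F) (Idn A x) = Idn C (ObjMap (cat_comp A G F) x)"
      using eq[OF F.A.idn_hom[OF x]] eqo[OF x] F.map_idn[OF x] G.map_idn[OF F.obj_map[OF x]] by simp
  next
    fix f x y g z assume f: "f \<in> hom A x y" and g: "g \<in> hom A y z"
    show "ArrMap (cat_comp A G F) (g \<cdot>\<^bsub>A\<^esub> f)
      = ArrMap (cat_comp A G F) g \<cdot>\<^bsub>C\<^esub> ArrMap (cat_comp A G F) f"
      using eq[OF f] eq[OF g] eq[OF F.A.cmp_hom[OF f g]] F.map_cmp[OF f g]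
        G.map_cmp[OF F.arr_map[OF f] F.arr_map[OF g]] by simp
  qed
qed

lemma cat_comp_ObjMap: "x \<in> Obj A \<Longrightarrow> ObjMap (cat_comp A G F) x = ObjMap G (ObjMap F x)"
  by (simp add: cat_comp_def compose_def)

lemma cat_comp_ArrMap: "f \<in> Arr A \<Longrightarrow> ArrMap (cat_comp A G F) f = ArrMap G (ArrMap F f)"
  by (simp add: cat_comp_def compose_def)

section \<open>Functor categories and precomposition\<close>

lemma functor_category_simps:
  "Obj (functor_category A B) = {F. cat_functor A B F \<and>
     ObjMap F \<in> extensional (Obj A) \<and> ArrMap F \<in> extensional (Arr A)}"
  "Dom (functor_category A B) = (\<lambda>(F, G, t). F)"
  "Cod (functor_category A B) = (\<lambda>(F, G, t). G)"
  "Idn (functor_category A B) = (\<lambda>F. (F, F, \<lambda>x \<in> Obj A. Idn B (ObjMap F x)))"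
  "Cmp (functor_category A B) =
     (\<lambda>(F', G', t') (F, G, t). (F, G', \<lambda>x \<in> Obj A. t' x \<cdot>\<^bsub>B\<^esub> t x))"
  by (simp_all add: functor_category_def Let_def)

lemma hom_functor_category:
  "hom (functor_category A B) F G = {(F, G, t) | t. F \<in> Obj (functor_category A B) \<and>
     G \<in> Obj (functor_category A B) \<and> nat_trans A B F G t \<and> t \<in> extensional (Obj A)}"
  by (auto simp: hom_def functor_category_def Let_def)

lemma nat_trans_id:
  assumes "cat_functor A B F"
  shows "nat_trans A B F F (\<lambda>x \<in> Obj A. Idn B (ObjMap F x))"
proof -
  interpret F: cat_functor A B F by fact
  show ?thesis
    unfolding nat_trans_def
    using assms F.B.idn_hom F.obj_map F.A.dom_obj F.A.cod_obj
      F.B.cmp_idn_left[OF F.arr_map[OF F.A.arr_hom]] F.B.cmp_idn_right[OF F.arr_map[OF F.A.arr_hom]]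
    by auto
qed

lemma nat_trans_cmp:
  assumes t: "nat_trans A B F G t" and u: "nat_trans A B G H u"
  shows "nat_trans A B F H (\<lambda>x \<in> Obj A. u x \<cdot>\<^bsub>B\<^esub> t x)"
proof -
  interpret F: cat_functor A B F using t by (simp add: nat_trans_def)
  interpret G: cat_functor A B G using t by (simp add: nat_trans_def)
  interpret H: cat_functor A B H using u by (simp add: nat_trans_def)
  have "u y \<cdot>\<^bsub>B\<^esub> t y \<cdot>\<^bsub>B\<^esub> ArrMap F f = ArrMap H f \<cdot>\<^bsub>B\<^esub> (u x \<cdot>\<^bsub>B\<^esub> t x)"
    if f: "f \<in> Arr A" and [simp]: "x = Dom A f" "y = Cod A f" for f x y
  proof -
    have xy: "x \<in> Obj A" "y \<in> Obj A" using f F.A.dom_obj F.A.cod_obj by auto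
    note Ff = F.arr_map[OF F.A.arr_hom[OF f]] and Gf = G.arr_map[OF F.A.arr_hom[OF f]]
      and Hf = H.arr_map[OF F.A.arr_hom[OF f]]
    have tx: "t x \<in> hom B (ObjMap F x) (ObjMap G x)" "t y \<in> hom B (ObjMap F y) (ObjMap G y)"
      and ux: "u x \<in> hom B (ObjMap G x) (ObjMap H x)" "u y \<in> hom B (ObjMap G y) (ObjMap H y)"
      using t u xy by (simp_all add: nat_trans_def)
    have "t y \<cdot>\<^bsub>B\<^esub> ArrMap F f = ArrMap G f \<cdot>\<^bsub>B\<^esub> t x" "u y \<cdot>\<^bsub>B\<^esub> ArrMap G f = ArrMap H f \<cdot>\<^bsub>B\<^esub> u x"
      using t u f by (simp_all add: nat_trans_def)
    then show ?thesis
      using F.B.cmp_assoc[OF Ff[folded that(2,3)] tx(2) ux(2)] F.B.cmp_assoc[OF tx(1) Gf[folded that(2,3)] ux(2)]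
        F.B.cmp_assoc[OF tx(1) ux(1) Hf[folded that(2,3)]] by simp
  qed
  then show ?thesis
    using t u F.A.dom_obj F.A.cod_obj F.B.cmp_hom unfolding nat_trans_def by fastforce
qed

lemma category_functor_category:
  assumes A: "category A" and B: "category B"
  shows "category (functor_category A B)"
proof -
  interpret A: category A by fact
  interpret B: category B by fact
  show ?thesis
  proof
    fix f assume "f \<in> Arr (functor_category A B)"
    then show "Dom (functor_category A B) f \<in> Obj (functor_category A B)"
      "Cod (functor_category A B) f \<in> Obj (functor_category A B)"
      by (auto simp: functor_category_def Let_def)
  next
    fix F assume "F \<in> Obj (functor_category A B)"
    then show "Idn (functor_category A B) F \<in> hom (functor_category A B) F F"
      using nat_trans_id[of A B F] by (auto simp: hom_functor_category functor_category_simps)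
  next
    fix F G H s t
    assume "s \<in> hom (functor_category A B) F G" "t \<in> hom (functor_category A B) G H"
    then show "t \<cdot>\<^bsub>functor_category A B\<^esub> s \<in> hom (functor_category A B) F H"
      by (auto simp: hom_functor_category functor_category_simps intro: nat_trans_cmp)
  next
    fix F G s assume "s \<in> hom (functor_category A B) F G"
    then show "Idn (functor_category A B) G \<cdot>\<^bsub>functor_category A B\<^esub> s = s"
      "s \<cdot>\<^bsub>functor_category A B\<^esub> Idn (functor_category A B) F = s"
      by (auto simp: hom_functor_category functor_category_simps nat_trans_def
          intro!: extensionalityI[where A = "Obj A"] B.cmp_idn_left B.cmp_idn_right)
  next
    fix F G H K s t u
    assume "s \<in> hom (functor_category A B) F G" "t \<in> hom (functor_category A B) G H"
      "u \<in> hom (functor_category A B) H K"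
    then show "u \<cdot>\<^bsub>functor_category A B\<^esub> t \<cdot>\<^bsub>functor_category A B\<^esub> s
      = u \<cdot>\<^bsub>functor_category A B\<^esub> (t \<cdot>\<^bsub>functor_category A B\<^esub> s)"
      by (auto simp: hom_functor_category functor_category_simps nat_trans_def
          intro!: extensionalityI[where A = "Obj A"] B.cmp_assoc)
  qed
qed

lemma cat_comp_in_functor_category:
  assumes "cat_functor C H L" "cat_functor H D G"
  shows "cat_comp C G L \<in> Obj (functor_category C D)"
  using cat_functor_cat_comp[OF assms]
  by (auto simp: functor_category_simps cat_comp_def compose_def)

lemma nat_trans_precomposition:
  assumes L: "cat_functor C H L" and t: "nat_trans H D G G' t"
  shows "nat_trans C D (cat_comp C G L) (cat_comp C G' L) (compose (Obj C) t (ObjMap L))"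
proof -
  interpret L: cat_functor C H L by fact
  have G: "cat_functor H D G" "cat_functor H D G'" using t by (auto simp: nat_trans_def)
  have "t (ObjMap L (Cod C f)) \<cdot>\<^bsub>D\<^esub> ArrMap G (ArrMap L f)
      = ArrMap G' (ArrMap L f) \<cdot>\<^bsub>D\<^esub> t (ObjMap L (Dom C f))" if "f \<in> Arr C" for f
    using L.arr_map[OF L.A.arr_hom[OF that]] t by (auto simp: nat_trans_def hom_def)
  then show ?thesis
    using t cat_functor_cat_comp[OF L G(1)] cat_functor_cat_comp[OF L G(2)] L.obj_map L.A.dom_obj L.A.cod_obj
    by (auto simp: nat_trans_def cat_comp_ObjMap cat_comp_ArrMap compose_def)
qed

lemma cat_functor_precomposition:
  assumes L: "cat_functor C H L" and D: "category D"
  shows "cat_functor (functor_category H D) (functor_category C D) (precomposition C L)"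
proof -
  interpret L: cat_functor C H L by fact
  interpret HD: category "functor_category H D"
    using category_functor_category[OF L.B.category_axioms D] .
  interpret CD: category "functor_category C D"
    using category_functor_category[OF L.A.category_axioms D] .
  have obj: "cat_comp C G L \<in> Obj (functor_category C D)" if "G \<in> Obj (functor_category H D)" for G
    using that by (auto intro: cat_comp_in_functor_category[OF L] simp: functor_category_simps(1)[of H])
  show ?thesis
  proof
    fix G assume "G \<in> Obj (functor_category H D)"
    then show "ObjMap (precomposition C L) G \<in> Obj (functor_category C D)"
      by (simp add: precomposition_def obj)
  next
    fix t G G' assume "t \<in> hom (functor_category H D) G G'"
    then show "ArrMap (precomposition C L) t \<in> hom (functor_category C D)
        (ObjMap (precomposition C L) G) (ObjMap (precomposition C L) G')"
      using nat_trans_precomposition[OF L]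
      by (auto simp: hom_functor_category precomposition_def obj compose_def)
  next
    fix G assume "G \<in> Obj (functor_category H D)"
    then show "ArrMap (precomposition C L) (Idn (functor_category H D) G)
      = Idn (functor_category C D) (ObjMap (precomposition C L) G)"
      by (auto simp: functor_category_simps precomposition_def compose_def cat_comp_ObjMap L.obj_map
          intro!: restrict_ext)
  next
    fix t G G' t' G''
    assume "t \<in> hom (functor_category H D) G G'" "t' \<in> hom (functor_category H D) G' G''"
    then show "ArrMap (precomposition C L) (t' \<cdot>\<^bsub>functor_category H D\<^esub> t)
      = ArrMap (precomposition C L) t' \<cdot>\<^bsub>functor_category C D\<^esub> ArrMap (precomposition C L) t"
      by (auto simp: functor_category_simps hom_functor_category precomposition_def compose_def L.obj_map
          intro!: restrict_ext)
  qed
qed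

text \<open>The function \<open>S\<close> is a section of \<open>L\<close> on objects through which every arrow of \<open>H\<close> can be
  represented, so a transformation between functors on \<open>H\<close> can be read off from its restriction
  along \<open>L\<close> at the objects \<open>S z\<close>. Conversely, a transformation \<open>t\<close> between functors restricted
  along \<open>L\<close> takes the same value at the source and target of an arrow that \<open>L\<close> sends to an identity;
  the zigzag thus forces \<open>t x = t (S (L x))\<close>, and \<open>t\<close> is the restriction of \<open>z \<mapsto> t (S z)\<close>.\<close>
lemma precomposition_fully_faithful:
  assumes L: "cat_functor C H L" and D: "category D"
    and S: "\<And>z. z \<in> Obj H \<Longrightarrow> S z \<in> Obj C \<and> ObjMap L (S z) = z"
    and full: "\<And>z z' k. k \<in> hom H z z' \<Longrightarrow> \<exists>f \<in> hom C (S z) (S z'). ArrMap L f = k"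
    and zigzag: "\<And>x. x \<in> Obj C \<Longrightarrow> \<exists>v. \<exists>a \<in> hom C v x. \<exists>b \<in> hom C v (S (ObjMap L x)).
      ArrMap L a = Idn H (ObjMap L x) \<and> ArrMap L b = Idn H (ObjMap L x)"
  shows "fully_faithful (functor_category H D) (functor_category C D) (precomposition C L)"
  unfolding fully_faithful_def
proof (intro conjI ballI)
  interpret L: cat_functor C H L by fact
  interpret D: category D by fact
  show "cat_functor (functor_category H D) (functor_category C D) (precomposition C L)"
    by (rule cat_functor_precomposition[OF L D])
  fix G G' assume G: "G \<in> Obj (functor_category H D)" and G': "G' \<in> Obj (functor_category H D)"
  interpret G: cat_functor H D G using G by (simp add: functor_category_simps)
  interpret G': cat_functor H D G' using G' by (simp add: functor_category_simps)
  let ?P = "precomposition C L"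
  show "bij_betw (ArrMap ?P) (hom (functor_category H D) G G')
    (hom (functor_category C D) (ObjMap ?P G) (ObjMap ?P G'))"
    unfolding bij_betw_def
  proof (intro conjI inj_onI subset_antisym subsetI)
    fix T U assume T: "T \<in> hom (functor_category H D) G G'" "U \<in> hom (functor_category H D) G G'"
      and eq: "ArrMap ?P T = ArrMap ?P U"
    obtain t u where tu: "T = (G, G', t)" "U = (G, G', u)" "t \<in> extensional (Obj H)"
      "u \<in> extensional (Obj H)" using T by (auto simp: hom_functor_category)
    have "compose (Obj C) t (ObjMap L) = compose (Obj C) u (ObjMap L)"
      using eq by (simp add: tu precomposition_def)
    then have "t z = u z" if "z \<in> Obj H" for z
      using S[OF that] by (metis compose_eq)
    then show "T = U" using tu by (auto intro: extensionalityI)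
  next
    fix T assume "T \<in> ArrMap ?P ` hom (functor_category H D) G G'"
    then show "T \<in> hom (functor_category C D) (ObjMap ?P G) (ObjMap ?P G')"
      using cat_functor.arr_map[OF cat_functor_precomposition[OF L D]] by blast
  next
    fix T assume "T \<in> hom (functor_category C D) (ObjMap ?P G) (ObjMap ?P G')"
    then obtain t where T: "T = (cat_comp C G L, cat_comp C G' L, t)"
      and t: "nat_trans C D (cat_comp C G L) (cat_comp C G' L) t" and ext: "t \<in> extensional (Obj C)"
      by (auto simp: hom_functor_category precomposition_def)
    have t_hom: "t x \<in> hom D (ObjMap G (ObjMap L x)) (ObjMap G' (ObjMap L x))" if "x \<in> Obj C" for x
      using t that by (auto simp: nat_trans_def cat_comp_ObjMap)
    have t_nat: "t y \<cdot>\<^bsub>D\<^esub> ArrMap G (ArrMap L f) = ArrMap G' (ArrMap L f) \<cdot>\<^bsub>D\<^esub> t x"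
      if "f \<in> hom C x y" for f x y
      using t that by (auto simp: nat_trans_def cat_comp_ArrMap hom_def)
    \<comment> \<open>The hypothesis on \<open>f\<close> forces its source and target to have the same image under \<open>L\<close>.\<close>
    have same: "t y = t x"
      if f: "f \<in> hom C x y" and i: "ArrMap L f = Idn H (ObjMap L y)" for f x y
    proof -
      have x: "x \<in> Obj C" and y: "y \<in> Obj C" using f L.A.hom_obj by auto
      have "Idn H (ObjMap L y) \<in> hom H (ObjMap L x) (ObjMap L y)" using L.arr_map[OF f] i by simp
      then have [simp]: "ObjMap L x = ObjMap L y"
        using L.B.idn_hom[OF L.obj_map[OF y]] by (auto simp: hom_def)
      note Ly = L.obj_map[OF y]
      show ?thesis
        using t_nat[OF f] t_hom[OF x] t_hom[OF y] G.map_idn[OF Ly] G'.map_idn[OF Ly]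
        by (simp add: i D.cmp_idn_left D.cmp_idn_right)
    qed
    have tS: "t (S (ObjMap L x)) = t x" if x: "x \<in> Obj C" for x
    proof -
      obtain v a b where ab: "a \<in> hom C v x" "b \<in> hom C v (S (ObjMap L x))"
        "ArrMap L a = Idn H (ObjMap L x)" "ArrMap L b = Idn H (ObjMap L x)"
        using zigzag[OF x] by blast
      then show ?thesis
        using same[OF ab(1)] same[OF ab(2)] S[OF L.obj_map[OF x]] by simp
    qed
    define u where "u = (\<lambda>z \<in> Obj H. t (S z))"
    have "nat_trans H D G G' u"
      unfolding nat_trans_def
    proof (intro conjI ballI)
      show "cat_functor H D G" "cat_functor H D G'" by unfold_locales
      fix z assume "z \<in> Obj H"
      then show "u z \<in> hom D (ObjMap G z) (ObjMap G' z)"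
        using t_hom[of "S z"] S[of z] by (simp add: u_def)
    next
      fix k assume k: "k \<in> Arr H"
      obtain f where "f \<in> hom C (S (Dom H k)) (S (Cod H k))" "ArrMap L f = k"
        using full[OF L.B.arr_hom[OF k]] by blast
      then show "u (Cod H k) \<cdot>\<^bsub>D\<^esub> ArrMap G k = ArrMap G' k \<cdot>\<^bsub>D\<^esub> u (Dom H k)"
        using t_nat L.B.dom_obj[OF k] L.B.cod_obj[OF k] by (simp add: u_def) blast
    qed
    then have "(G, G', u) \<in> hom (functor_category H D) G G'"
      using G G' by (auto simp: hom_functor_category u_def)
    moreover have "compose (Obj C) u (ObjMap L) = t"
      using ext by (intro extensionalityI[where A = "Obj C"])
        (auto simp: compose_def u_def L.obj_map tS)
    then have "ArrMap ?P (G, G', u) = T"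
      by (simp add: T precomposition_def)
    ultimately show "T \<in> ArrMap ?P ` hom (functor_category H D) G G'"
      by (metis image_eqI)
  qed
qed

section \<open>The self-dual core of a model category\<close>

definition opposite_model ::
  "('o, 'm, 'z) model_structure_scheme \<Rightarrow> ('o, 'm, 'z) model_structure_scheme" where
  "opposite_model M = M\<lparr>Dom := Cod M, Cod := Dom M, Cmp := (\<lambda>g f. f \<cdot>\<^bsub>M\<^esub> g),
     Cofib := Fibr M, Fibr := Cofib M\<rparr>"

lemma opposite_model_simps [simp]:
  "Obj (opposite_model M) = Obj M" "Arr (opposite_model M) = Arr M"
  "Dom (opposite_model M) = Cod M" "Cod (opposite_model M) = Dom M"
  "Idn (opposite_model M) = Idn M" "g \<cdot>\<^bsub>opposite_model M\<^esub> f = f \<cdot>\<^bsub>M\<^esub> g"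
  "WEq (opposite_model M) = WEq M" "Cofib (opposite_model M) = Fibr M"
  "Fibr (opposite_model M) = Cofib M"
  by (simp_all add: opposite_model_def)

lemma hom_opposite_model [simp]: "hom (opposite_model M) x y = hom M y x"
  by (auto simp: hom_def)

text \<open>The part of the theory of model categories on which homotopy theory rests, in a form that
  is visibly invariant under passing to the opposite category: retract axioms enter only as
  characterizations by lifting, (co)limits only as initial and terminal objects and binary
  (co)products, and factorizations only one arrow at a time.\<close>
locale model_core = category M
  for M :: "('o, 'm, 'z) model_structure_scheme" (structure) +
  assumes weq_arr: "WEq M \<subseteq> Arr M"
    and cofib_arr: "Cofib M \<subseteq> Arr M"
    and fibr_arr: "Fibr M \<subseteq> Arr M"
    and weq_cmp: "f \<in> hom M x y \<Longrightarrow> g \<in> hom M y z \<Longrightarrow> f \<in> WEq M \<Longrightarrow> g \<in> WEq M \<Longrightarrow>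
      g \<cdot> f \<in> WEq M"
    and weq_cancel_left: "f \<in> hom M x y \<Longrightarrow> g \<in> hom M y z \<Longrightarrow> g \<in> WEq M \<Longrightarrow> g \<cdot> f \<in> WEq M \<Longrightarrow>
      f \<in> WEq M"
    and weq_cancel_right: "f \<in> hom M x y \<Longrightarrow> g \<in> hom M y z \<Longrightarrow> f \<in> WEq M \<Longrightarrow> g \<cdot> f \<in> WEq M \<Longrightarrow>
      g \<in> WEq M"
    and lift_cofib: "i \<in> Cofib M \<Longrightarrow> p \<in> Fibr M \<inter> WEq M \<Longrightarrow> has_lifting M i p"
    and lift_fibr: "i \<in> Cofib M \<inter> WEq M \<Longrightarrow> p \<in> Fibr M \<Longrightarrow> has_lifting M i p"
    and cofibI: "i \<in> Arr M \<Longrightarrow> (\<And>p. p \<in> Fibr M \<inter> WEq M \<Longrightarrow> has_lifting M i p) \<Longrightarrow> i \<in> Cofib M"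
    and fibrI: "p \<in> Arr M \<Longrightarrow> (\<And>i. i \<in> Cofib M \<inter> WEq M \<Longrightarrow> has_lifting M i p) \<Longrightarrow> p \<in> Fibr M"
    and factor_cofib: "f \<in> hom M x y \<Longrightarrow>
      \<exists>e. \<exists>a \<in> hom M x e. \<exists>b \<in> hom M e y. a \<in> Cofib M \<and> b \<in> Fibr M \<inter> WEq M \<and> b \<cdot> a = f"
    and factor_fibr: "f \<in> hom M x y \<Longrightarrow>
      \<exists>e. \<exists>a \<in> hom M x e. \<exists>b \<in> hom M e y. a \<in> Cofib M \<inter> WEq M \<and> b \<in> Fibr M \<and> b \<cdot> a = f"
    and initial_exists: "\<exists>z. is_initial M z"
    and terminal_exists: "\<exists>z. is_terminal M z"
    and coproduct_exists: "x \<in> Obj M \<Longrightarrow> y \<in> Obj M \<Longrightarrow> \<exists>s i j. is_coproduct M x y s i j"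
    and product_exists: "x \<in> Obj M \<Longrightarrow> y \<in> Obj M \<Longrightarrow> \<exists>s p q. is_product M x y s p q"

section \<open>Every model category has the self-dual core\<close>

lemma is_retract_arrow_categoryI:
  assumes "category C" "f \<in> hom C x y" "g \<in> hom C x' y'"
    and "u \<in> hom C x x'" "v \<in> hom C y y'" "g \<cdot>\<^bsub>C\<^esub> u = v \<cdot>\<^bsub>C\<^esub> f"
    and "r \<in> hom C x' x" "s \<in> hom C y' y" "f \<cdot>\<^bsub>C\<^esub> r = s \<cdot>\<^bsub>C\<^esub> g"
    and "r \<cdot>\<^bsub>C\<^esub> u = Idn C x" "s \<cdot>\<^bsub>C\<^esub> v = Idn C y"
  shows "is_retract (arrow_category C) f g"
proof -
  have "(f, u, v, g) \<in> hom (arrow_category C) f g" "(g, r, s, f) \<in> hom (arrow_category C) g f"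
    using assms by (auto simp: arrow_category_def hom_def)
  moreover have "(g, r, s, f) \<cdot>\<^bsub>arrow_category C\<^esub> (f, u, v, g) = Idn (arrow_category C) f"
    using assms by (auto simp: arrow_category_def hom_def)
  ultimately show ?thesis by (auto simp: is_retract_def)
qed

text \<open>Initial objects and binary coproducts are colimits over the discrete categories on no and
  on two objects, and dually.\<close>
definition discrete_category :: "nat set \<Rightarrow> (nat, nat) category" where
  "discrete_category S = \<lparr>Obj = S, Arr = S, Dom = id, Cod = id, Idn = id, Cmp = (\<lambda>g f. f)\<rparr>"

definition discrete_diagram ::
  "('o, 'm, 'z) category_scheme \<Rightarrow> (nat \<Rightarrow> 'o) \<Rightarrow> (nat, nat, 'o, 'm) cat_map" where
  "discrete_diagram C X = \<lparr>ObjMap = X, ArrMap = (\<lambda>i. Idn C (X i))\<rparr>"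

lemma cat_functor_discrete_diagram:
  assumes "category C" "\<And>i. i \<in> S \<Longrightarrow> X i \<in> Obj C"
  shows "cat_functor (discrete_category S) C (discrete_diagram C X)"
proof -
  interpret category C by fact
  show ?thesis
    by unfold_locales
      (auto simp: discrete_category_def discrete_diagram_def hom_def assms idn_hom[unfolded hom_def, simplified]
        cmp_idn_left[OF idn_hom])
qed

lemma is_cone_discrete_diagram:
  assumes "category C"
  shows "is_cone (discrete_category S) C (discrete_diagram C X) x l \<longleftrightarrow>
    x \<in> Obj C \<and> (\<forall>j \<in> S. l j \<in> hom C x (X j))"
    and "is_cocone (discrete_category S) C (discrete_diagram C X) x l \<longleftrightarrow>
    x \<in> Obj C \<and> (\<forall>j \<in> S. l j \<in> hom C (X j) x)"
  using category.cmp_idn_left[OF assms] category.cmp_idn_right[OF assms]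
  by (auto simp: is_cone_def is_cocone_def discrete_category_def discrete_diagram_def)

context model_category
begin

lemma discrete_limit_exists:
  fixes S :: "nat set"
  assumes "finite S" "\<forall>i \<in> S. X i \<in> Obj M"
  shows "\<exists>x l. x \<in> Obj M \<and> (\<forall>j \<in> S. l j \<in> hom M x (X j)) \<and>
    (\<forall>y k. y \<in> Obj M \<and> (\<forall>j \<in> S. k j \<in> hom M y (X j)) \<longrightarrow>
      (\<exists>!u. u \<in> hom M y x \<and> (\<forall>j \<in> S. l j \<cdot> u = k j)))"
proof -
  have "\<exists>x l. is_limit (discrete_category S) M (discrete_diagram M X) x l"
    using finite_limits cat_functor_discrete_diagram[OF category_axioms assms(2)[rule_format]] assms(1)
    unfolding has_finite_limits_def by (simp add: discrete_category_def)
  then show ?thesis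
    unfolding is_limit_def is_cone_discrete_diagram[OF category_axioms]
    by (simp add: discrete_category_def)
qed

lemma discrete_colimit_exists:
  fixes S :: "nat set"
  assumes "finite S" "\<forall>i \<in> S. X i \<in> Obj M"
  shows "\<exists>x l. x \<in> Obj M \<and> (\<forall>j \<in> S. l j \<in> hom M (X j) x) \<and>
    (\<forall>y k. y \<in> Obj M \<and> (\<forall>j \<in> S. k j \<in> hom M (X j) y) \<longrightarrow>
      (\<exists>!u. u \<in> hom M x y \<and> (\<forall>j \<in> S. u \<cdot> l j = k j)))"
proof -
  have "\<exists>x l. is_colimit (discrete_category S) M (discrete_diagram M X) x l"
    using finite_colimits cat_functor_discrete_diagram[OF category_axioms assms(2)[rule_format]] assms(1)
    unfolding has_finite_colimits_def by (simp add: discrete_category_def)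
  then show ?thesis
    unfolding is_colimit_def is_cone_discrete_diagram[OF category_axioms]
    by (simp add: discrete_category_def)
qed

lemma binary_product_exists:
  assumes "x \<in> Obj M" "y \<in> Obj M"
  shows "\<exists>s p q. is_product M x y s p q"
proof -
  let ?X = "\<lambda>i::nat. if i = 0 then x else y"
  have fin: "finite {0, 1::nat}" by simp
  have X: "\<forall>i \<in> {0, 1}. ?X i \<in> Obj M" using assms by simp
  obtain s l where s: "s \<in> Obj M" and l: "\<forall>j \<in> {0,1}. l j \<in> hom M s (?X j)"
    and univ: "\<forall>z k. z \<in> Obj M \<and> (\<forall>j \<in> {0,1}. k j \<in> hom M z (?X j)) \<longrightarrow>
      (\<exists>!u. u \<in> hom M z s \<and> (\<forall>j \<in> {0,1}. l j \<cdot> u = k j))"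
    using discrete_limit_exists[of "{0,1}" ?X, OF fin X]
    by (elim exE conjE) (rule that)
  have "is_product M x y s (l 0) (l 1)"
    unfolding is_product_def
  proof (intro conjI allI ballI)
    show "l 0 \<in> hom M s x" "l 1 \<in> hom M s y" using l by auto
    fix z f g assume fg: "f \<in> hom M z x" "g \<in> hom M z y"
    then show "\<exists>!u. u \<in> hom M z s \<and> l 0 \<cdot> u = f \<and> l 1 \<cdot> u = g"
      using univ[rule_format, of z "\<lambda>i. if i = 0 then f else g"] hom_obj(1)[OF fg(1)] by simp
  qed
  then show ?thesis by blast
qed

lemma binary_coproduct_exists:
  assumes "x \<in> Obj M" "y \<in> Obj M"
  shows "\<exists>s i j. is_coproduct M x y s i j"
proof -
  let ?X = "\<lambda>i::nat. if i = 0 then x else y"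
  have fin: "finite {0, 1::nat}" by simp
  have X: "\<forall>i \<in> {0, 1}. ?X i \<in> Obj M" using assms by simp
  obtain s l where s: "s \<in> Obj M" and l: "\<forall>j \<in> {0,1}. l j \<in> hom M (?X j) s"
    and univ: "\<forall>z k. z \<in> Obj M \<and> (\<forall>j \<in> {0,1}. k j \<in> hom M (?X j) z) \<longrightarrow>
      (\<exists>!u. u \<in> hom M s z \<and> (\<forall>j \<in> {0,1}. u \<cdot> l j = k j))"
    using discrete_colimit_exists[of "{0,1}" ?X, OF fin X]
    by (elim exE conjE) (rule that)
  have "is_coproduct M x y s (l 0) (l 1)"
    unfolding is_coproduct_def
  proof (intro conjI allI ballI)
    show "l 0 \<in> hom M x s" "l 1 \<in> hom M y s" using l by auto
    fix z f g assume fg: "f \<in> hom M x z" "g \<in> hom M y z"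
    then show "\<exists>!u. u \<in> hom M s z \<and> u \<cdot> l 0 = f \<and> u \<cdot> l 1 = g"
      using univ[rule_format, of z "\<lambda>i. if i = 0 then f else g"] hom_obj(2)[OF fg(1)] by simp
  qed
  then show ?thesis by blast
qed

lemma functorial_factorization_arrow:
  assumes "has_functorial_factorization M L R" "f \<in> hom M x y"
  shows "\<exists>e. \<exists>a \<in> hom M x e. \<exists>b \<in> hom M e y. a \<in> L \<and> b \<in> R \<and> b \<cdot> a = f"
proof -
  obtain E a b where ab: "nat_trans (arrow_category M) M (dom_functor M) E a"
    "nat_trans (arrow_category M) M E (cod_functor M) b"
    "\<forall>f \<in> Arr M. a f \<in> L \<and> b f \<in> R \<and> b f \<cdot> a f = f"
    using assms(1) by (auto simp: has_functorial_factorization_def)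
  have "f \<in> Arr M" "f \<in> Obj (arrow_category M)" "Dom M f = x" "Cod M f = y"
    using assms(2) by (auto simp: hom_def arrow_category_def)
  then have "a f \<in> hom M x (ObjMap E f)" "b f \<in> hom M (ObjMap E f) y"
    using ab(1,2) unfolding nat_trans_def dom_functor_def cod_functor_def by fastforce+
  then show ?thesis
    using ab(3) \<open>f \<in> Arr M\<close> by blast
qed

text \<open>The retract argument: lifting \<open>i\<close> against the trivial fibration of its factorization
  exhibits \<open>i\<close> as a retract of a cofibration.\<close>
lemma cofib_if_lifting:
  assumes i: "i \<in> Arr M" and lift: "\<And>p. p \<in> Fibr M \<inter> WEq M \<Longrightarrow> has_lifting M i p"
  shows "i \<in> Cofib M"
proof -
  let ?x = "Dom M i" and ?y = "Cod M i"
  note ih = arr_hom[OF i]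
  obtain e a b where ab: "a \<in> hom M ?x e" "b \<in> hom M e ?y" "a \<in> Cofib M" "b \<in> Fibr M \<inter> WEq M" "b \<cdot> a = i"
    using functorial_factorization_arrow[OF factor_cofib ih] by blast
  have idy: "Idn M ?y \<in> hom M ?y ?y" and idx: "Idn M ?x \<in> hom M ?x ?x" using idn_hom hom_obj[OF ih] by auto
  have "b \<cdot> a = Idn M ?y \<cdot> i" using ab(5) cmp_idn_left[OF ih] by simp
  then obtain h where h: "h \<in> hom M ?y e" "h \<cdot> i = a" "b \<cdot> h = Idn M ?y"
    using lift[OF ab(4)] ab(1,2) idy unfolding has_lifting_def by (auto simp: hom_def)
  have "is_retract (arrow_category M) i a"
    by (rule is_retract_arrow_categoryI[OF category_axioms ih ab(1) idx h(1) _ idx ab(2)])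
      (simp_all add: h ab(5) cmp_idn_right[OF ab(1)] cmp_idn_right[OF ih] cmp_idn_left[OF idx])
  then show ?thesis
    using cofib_retract ab(3) unfolding retract_closed_def by blast
qed

lemma fibr_if_lifting:
  assumes p: "p \<in> Arr M" and lift: "\<And>i. i \<in> Cofib M \<inter> WEq M \<Longrightarrow> has_lifting M i p"
  shows "p \<in> Fibr M"
proof -
  let ?x = "Dom M p" and ?y = "Cod M p"
  note ph = arr_hom[OF p]
  obtain e a b where ab: "a \<in> hom M ?x e" "b \<in> hom M e ?y" "a \<in> Cofib M \<inter> WEq M" "b \<in> Fibr M" "b \<cdot> a = p"
    using functorial_factorization_arrow[OF factor_fibr ph] by blast
  have idy: "Idn M ?y \<in> hom M ?y ?y" and idx: "Idn M ?x \<in> hom M ?x ?x" using idn_hom hom_obj[OF ph] by auto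
  have "p \<cdot> Idn M ?x = b \<cdot> a" using ab(5) cmp_idn_right[OF ph] by simp
  then obtain h where h: "h \<in> hom M e ?x" "h \<cdot> a = Idn M ?x" "p \<cdot> h = b"
    using lift[OF ab(3)] ab(1,2) idx unfolding has_lifting_def by (auto simp: hom_def)
  have "is_retract (arrow_category M) p b"
    by (rule is_retract_arrow_categoryI[OF category_axioms ph ab(2) ab(1) idy _ h(1) idy])
      (simp_all add: h ab(5) cmp_idn_left[OF ab(2)] cmp_idn_left[OF ph] cmp_idn_left[OF idy])
  then show ?thesis
    using fibr_retract ab(4) unfolding retract_closed_def by blast
qed

lemma model_core: "model_core M"
proof unfold_locales
  show "\<exists>z. is_initial M z"
    using discrete_colimit_exists[of "{}" undefined] unfolding is_initial_def by simp blast
  show "\<exists>z. is_terminal M z"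
    using discrete_limit_exists[of "{}" undefined] unfolding is_terminal_def by simp blast
qed (fact weq_arr cofib_arr fibr_arr weq_cmp weq_cancel_left weq_cancel_right lift_cofib lift_fibr cofib_if_lifting fibr_if_lifting
    functorial_factorization_arrow[OF factor_cofib] functorial_factorization_arrow[OF factor_fibr]
    binary_coproduct_exists binary_product_exists)+

end

section \<open>Duality\<close>

lemma is_coproduct_opposite_model [simp]:
  "is_coproduct (opposite_model M) x y s i j \<longleftrightarrow> is_product M x y s i j"
  by (simp add: is_coproduct_def is_product_def)

lemma is_product_opposite_model [simp]:
  "is_product (opposite_model M) x y s i j \<longleftrightarrow> is_coproduct M x y s i j"
  by (simp add: is_coproduct_def is_product_def)

lemma is_initial_opposite_model [simp]: "is_initial (opposite_model M) x \<longleftrightarrow> is_terminal M x"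
  by (simp add: is_initial_def is_terminal_def)

lemma is_terminal_opposite_model [simp]: "is_terminal (opposite_model M) x \<longleftrightarrow> is_initial M x"
  by (simp add: is_initial_def is_terminal_def)

lemma cofibrant_opposite_model [simp]: "cofibrant (opposite_model M) x \<longleftrightarrow> fibrant M x"
  by (simp add: cofibrant_def fibrant_def)

lemma fibrant_opposite_model [simp]: "fibrant (opposite_model M) x \<longleftrightarrow> cofibrant M x"
  by (simp add: cofibrant_def fibrant_def)

lemma is_cylinder_opposite_model [simp]:
  "is_cylinder (opposite_model M) x c i0 i1 s \<longleftrightarrow> is_path_object M x c i0 i1 s"
  by (simp add: is_cylinder_def is_path_object_def)

lemma is_path_object_opposite_model [simp]:
  "is_path_object (opposite_model M) x c i0 i1 s \<longleftrightarrow> is_cylinder M x c i0 i1 s"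
  by (simp add: is_cylinder_def is_path_object_def)

lemma left_homotopic_opposite_model [simp]:
  "left_homotopic (opposite_model M) f g \<longleftrightarrow> right_homotopic M f g"
  by (auto simp: left_homotopic_def right_homotopic_def hom_def)

lemma right_homotopic_opposite_model [simp]:
  "right_homotopic (opposite_model M) f g \<longleftrightarrow> left_homotopic M f g"
  by (auto simp: left_homotopic_def right_homotopic_def hom_def)

lemma has_lifting_opposite_model [simp]:
  "has_lifting (opposite_model M) i p \<longleftrightarrow> has_lifting M p i"
  by (auto simp: has_lifting_def) metis+

lemma local_cofibrant_replacement_opposite_model [simp]:
  "local_cofibrant_replacement (opposite_model M) R \<longleftrightarrow> local_fibrant_replacement M R"
  by (auto simp: local_fibrant_replacement_def local_cofibrant_replacement_def)

context model_core
begin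

text \<open>The source of all dual statements below: a lemma about cofibrations and cylinders,
  instantiated at the opposite category, is its counterpart for fibrations and path objects.\<close>
lemma model_core_opposite: "model_core (opposite_model M)"
proof unfold_locales
  fix f x y assume f: "f \<in> hom (opposite_model M) x y"
  show "\<exists>e. \<exists>a\<in>hom (opposite_model M) x e. \<exists>b\<in>hom (opposite_model M) e y.
      a \<in> Cofib (opposite_model M) \<and> b \<in> Fibr (opposite_model M) \<inter> WEq (opposite_model M) \<and>
      b \<cdot>\<^bsub>opposite_model M\<^esub> a = f"
    using factor_fibr[of f y x] f by simp blast
  show "\<exists>e. \<exists>a\<in>hom (opposite_model M) x e. \<exists>b\<in>hom (opposite_model M) e y.
      a \<in> Cofib (opposite_model M) \<inter> WEq (opposite_model M) \<and> b \<in> Fibr (opposite_model M) \<and>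
      b \<cdot>\<^bsub>opposite_model M\<^esub> a = f"
    using factor_cofib[of f y x] f by simp blast
qed (auto simp: weq_arr[THEN subsetD] cofib_arr[THEN subsetD] fibr_arr[THEN subsetD] dom_obj cod_obj idn_hom cmp_idn_left cmp_idn_right cmp_assoc cmp_hom weq_cmp
    initial_exists terminal_exists coproduct_exists product_exists lift_cofib lift_fibr
    intro: weq_cancel_left weq_cancel_right cofibI fibrI)

end

section \<open>Homotopy of arrows\<close>

context model_core
begin

lemma trivial_fibration_lift:
  assumes "i \<in> Cofib M" "p \<in> Fibr M \<inter> WEq M" "i \<in> hom M a b" "p \<in> hom M x y"
    and "u \<in> hom M a x" "v \<in> hom M b y" "p \<cdot> u = v \<cdot> i"
  obtains h where "h \<in> hom M b x" "h \<cdot> i = u" "p \<cdot> h = v"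
  using lift_cofib[OF assms(1,2)] assms(3-) unfolding has_lifting_def by (auto simp: hom_def)

lemma cofibrant_lift:
  assumes "cofibrant M x" "p \<in> Fibr M \<inter> WEq M" "p \<in> hom M y z" "v \<in> hom M x z"
  obtains w where "w \<in> hom M x y" "p \<cdot> w = v"
proof -
  obtain o' i where o': "is_initial M o'" and i: "i \<in> hom M o' x" "i \<in> Cofib M"
    using assms(1) by (auto simp: cofibrant_def)
  obtain u where u: "u \<in> hom M o' y"
    using o' hom_obj(1)[OF assms(3)] by (auto simp: is_initial_def)
  have "p \<cdot> u = v \<cdot> i"
    using o' cmp_hom[OF u assms(3)] cmp_hom[OF i(1) assms(4)] hom_obj(2)[OF assms(3)]
    by (auto simp: is_initial_def)
  then show ?thesis
    using trivial_fibration_lift[OF i(2) assms(2) i(1) assms(3) u assms(4)] that by blast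
qed

lemma idn_weq:
  assumes "x \<in> Obj M"
  shows "Idn M x \<in> WEq M"
proof -
  obtain e a b where "b \<in> hom M e x" "b \<in> WEq M"
    using factor_cofib[OF idn_hom[OF assms]] by blast
  then show ?thesis
    using weq_cancel_right[OF _ idn_hom[OF assms]] cmp_idn_left by metis
qed

lemma idn_fibr:
  assumes "x \<in> Obj M"
  shows "Idn M x \<in> Fibr M"
proof (rule fibrI)
  note id = idn_hom[OF assms]
  show "Idn M x \<in> Arr M" by (rule hom_arr[OF id])
  fix i assume i: "i \<in> Cofib M \<inter> WEq M"
  have "Dom M (Idn M x) = x" "Cod M (Idn M x) = x" using id by (auto simp: hom_def)
  then show "has_lifting M i (Idn M x)"
    unfolding has_lifting_def using cmp_idn_left by simp
qed

lemma cofib_cmp: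
  assumes f: "f \<in> hom M x y" "f \<in> Cofib M" and g: "g \<in> hom M y z" "g \<in> Cofib M"
  shows "g \<cdot> f \<in> Cofib M"
proof (rule cofibI)
  note gf = cmp_hom[OF f(1) g(1)]
  then show "g \<cdot> f \<in> Arr M" by (rule hom_arr)
  fix p assume p: "p \<in> Fibr M \<inter> WEq M"
  have d: "Dom M (g \<cdot> f) = x" "Cod M (g \<cdot> f) = z" using gf by (auto simp: hom_def)
  show "has_lifting M (g \<cdot> f) p"
    unfolding has_lifting_def d
  proof (intro ballI impI)
    fix u v assume u: "u \<in> hom M x (Dom M p)" and v: "v \<in> hom M z (Cod M p)"
      and eq: "p \<cdot> u = v \<cdot> (g \<cdot> f)"
    have ph: "p \<in> hom M (Dom M p) (Cod M p)" using p fibr_arr by (auto simp: hom_def)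
    obtain h where h: "h \<in> hom M y (Dom M p)" "h \<cdot> f = u" "p \<cdot> h = v \<cdot> g"
      using trivial_fibration_lift[OF f(2) p f(1) ph u cmp_hom[OF g(1) v]] eq cmp_assoc[OF f(1) g(1) v]
      by metis
    obtain k where k: "k \<in> hom M z (Dom M p)" "k \<cdot> g = h" "p \<cdot> k = v"
      using trivial_fibration_lift[OF g(2) p g(1) ph h(1) v h(3)] .
    then show "\<exists>k\<in>hom M z (Dom M p). k \<cdot> (g \<cdot> f) = u \<and> p \<cdot> k = v"
      using h(2) cmp_assoc[OF f(1) g(1) k(1)] by auto
  qed
qed

lemma cofibrant_target:
  assumes "cofibrant M x" "i \<in> hom M x y" "i \<in> Cofib M"
  shows "cofibrant M y"
  using assms cofib_cmp hom_obj(2)[OF assms(2)] cmp_hom unfolding cofibrant_def by blast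

lemma cylinder_sym: "is_cylinder M x c i0 i1 s \<Longrightarrow> is_cylinder M x c i1 i0 s"
  unfolding is_cylinder_def is_coproduct_def by blast

lemma cylinder_hom:
  assumes "is_cylinder M x c i0 i1 s"
  shows "i0 \<in> hom M x c" "i1 \<in> hom M x c" "s \<in> hom M c x" "x \<in> Obj M"
    "s \<cdot> i0 = Idn M x" "s \<cdot> i1 = Idn M x" "s \<in> WEq M"
  using assms cmp_hom hom_obj unfolding is_cylinder_def is_coproduct_def by blast+

lemma cylinder_exists:
  assumes "x \<in> Obj M"
  shows "\<exists>c i0 i1 s. is_cylinder M x c i0 i1 s"
proof -
  obtain p j0 j1 where p: "is_coproduct M x x p j0 j1" using coproduct_exists[OF assms assms] by blast
  note id = idn_hom[OF assms]
  obtain d where d: "d \<in> hom M p x" "d \<cdot> j0 = Idn M x" "d \<cdot> j1 = Idn M x"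
    using p id unfolding is_coproduct_def by metis
  obtain c k s where k: "k \<in> hom M p c" "k \<in> Cofib M" and s: "s \<in> hom M c x" "s \<in> WEq M" "s \<cdot> k = d"
    using factor_cofib[OF d(1)] by blast
  have j: "j0 \<in> hom M x p" "j1 \<in> hom M x p" using p by (auto simp: is_coproduct_def)
  have "is_cylinder M x c (k \<cdot> j0) (k \<cdot> j1) s"
    unfolding is_cylinder_def
    using p k s d cmp_assoc[OF j(1) k(1) s(1)] cmp_assoc[OF j(2) k(1) s(1)] by auto
  then show ?thesis by blast
qed

text \<open>The two ends of a cylinder together form a cofibration out of a coproduct, so partial data
  on the two ends extend over the cylinder along a trivial fibration.\<close>
lemma cylinder_lift:
  assumes cyl: "is_cylinder M x c i0 i1 s" and q: "q \<in> Fibr M \<inter> WEq M" "q \<in> hom M y z"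
    and fg: "f \<in> hom M x y" "g \<in> hom M x y" and v: "v \<in> hom M c z" "q \<cdot> f = v \<cdot> i0" "q \<cdot> g = v \<cdot> i1"
  obtains h where "h \<in> hom M c y" "h \<cdot> i0 = f" "h \<cdot> i1 = g" "q \<cdot> h = v"
proof -
  obtain p j0 j1 k where p: "is_coproduct M x x p j0 j1" and k: "k \<in> hom M p c" "k \<in> Cofib M"
    and i: "i0 = k \<cdot> j0" "i1 = k \<cdot> j1"
    using cyl unfolding is_cylinder_def by blast
  have j: "j0 \<in> hom M x p" "j1 \<in> hom M x p" using p by (auto simp: is_coproduct_def)
  obtain u where u: "u \<in> hom M p y" "u \<cdot> j0 = f" "u \<cdot> j1 = g"
    using p fg unfolding is_coproduct_def by metis
  have "q \<cdot> u = v \<cdot> k"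
  proof -
    have "\<exists>!w. w \<in> hom M p z \<and> w \<cdot> j0 = q \<cdot> f \<and> w \<cdot> j1 = q \<cdot> g"
      using p cmp_hom[OF fg(1) q(2)] cmp_hom[OF fg(2) q(2)] unfolding is_coproduct_def by blast
    moreover have "q \<cdot> u \<cdot> j0 = q \<cdot> f" "q \<cdot> u \<cdot> j1 = q \<cdot> g"
      using cmp_assoc[OF j(1) u(1) q(2)] cmp_assoc[OF j(2) u(1) q(2)] u by auto
    moreover have "v \<cdot> k \<cdot> j0 = q \<cdot> f" "v \<cdot> k \<cdot> j1 = q \<cdot> g"
      using cmp_assoc[OF j(1) k(1) v(1)] cmp_assoc[OF j(2) k(1) v(1)] v i by auto
    ultimately show ?thesis
      using cmp_hom[OF u(1) q(2)] cmp_hom[OF k(1) v(1)] by blast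
  qed
  then obtain h where h: "h \<in> hom M c y" "h \<cdot> k = u" "q \<cdot> h = v"
    using trivial_fibration_lift[OF k(2) q(1) k(1) q(2) u(1) v(1)] by blast
  then show ?thesis
    using that[OF h(1)] u i cmp_assoc[OF j(1) k(1) h(1)] cmp_assoc[OF j(2) k(1) h(1)] by simp
qed

text \<open>The inclusion of \<open>x\<close> into its coproduct with itself is a cobase change of the cofibration
  from the initial object, hence a cofibration. Pushouts are avoided by checking the lifting
  property directly: a lift on the end \<open>i0\<close> is given, a lift on the end \<open>i1\<close> exists because \<open>x\<close> is
  cofibrant, and the two are joined over the cylinder.\<close>
lemma cylinder_end_trivial_cofibration:
  assumes x: "cofibrant M x" and cyl: "is_cylinder M x c i0 i1 s"
  shows "i0 \<in> Cofib M \<inter> WEq M"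
proof
  note cy = cylinder_hom[OF cyl]
  show "i0 \<in> WEq M"
    using weq_cancel_left[OF cy(1,3)] cy idn_weq by simp
  show "i0 \<in> Cofib M"
  proof (rule cofibI)
    show "i0 \<in> Arr M" by (rule hom_arr[OF cy(1)])
    have d: "Dom M i0 = x" "Cod M i0 = c" using cy by (auto simp: hom_def)
    fix p assume p: "p \<in> Fibr M \<inter> WEq M"
    show "has_lifting M i0 p"
      unfolding has_lifting_def d
    proof (intro ballI impI)
      fix u v assume u: "u \<in> hom M x (Dom M p)" and v: "v \<in> hom M c (Cod M p)" and eq: "p \<cdot> u = v \<cdot> i0"
      have ph: "p \<in> hom M (Dom M p) (Cod M p)" using p fibr_arr by (auto simp: hom_def)
      obtain w where w: "w \<in> hom M x (Dom M p)" "p \<cdot> w = v \<cdot> i1"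
        using cofibrant_lift[OF x p ph cmp_hom[OF cy(2) v]] .
      obtain h where "h \<in> hom M c (Dom M p)" "h \<cdot> i0 = u" "h \<cdot> i1 = w" "p \<cdot> h = v"
        using cylinder_lift[OF cyl p ph u w(1) v eq w(2)] .
      then show "\<exists>h\<in>hom M c (Dom M p). h \<cdot> i0 = u \<and> p \<cdot> h = v" by blast
    qed
  qed
qed

lemma path_object_hom:
  assumes "is_path_object M y c p0 p1 s"
  shows "p0 \<in> hom M c y" "p1 \<in> hom M c y" "s \<in> hom M y c" "y \<in> Obj M"
    "p0 \<cdot> s = Idn M y" "p1 \<cdot> s = Idn M y" "s \<in> WEq M"
  using model_core.cylinder_hom[OF model_core_opposite, of y c p0 p1 s] assms by simp_all

lemma path_object_lift:
  assumes "is_path_object M y c p0 p1 s" "i \<in> Cofib M \<inter> WEq M" "i \<in> hom M a b"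
    and "f \<in> hom M b y" "g \<in> hom M b y" "v \<in> hom M a c" "f \<cdot> i = p0 \<cdot> v" "g \<cdot> i = p1 \<cdot> v"
  obtains h where "h \<in> hom M b c" "p0 \<cdot> h = f" "p1 \<cdot> h = g" "h \<cdot> i = v"
  by (rule model_core.cylinder_lift[OF model_core_opposite, of y c p0 p1 s i b a f g v])
    (use assms that in simp_all)

lemma left_homotopicI:
  assumes "is_cylinder M x c i0 i1 s" "h \<in> hom M c y" "h \<cdot> i0 = f" "h \<cdot> i1 = g"
  shows "left_homotopic M f g"
proof -
  note cy = cylinder_hom[OF assms(1)]
  have "f \<in> hom M x y" "g \<in> hom M x y" using cmp_hom cy assms by blast+
  then show ?thesis using assms unfolding left_homotopic_def by (auto simp: hom_def)
qed

lemma left_homotopicE: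
  assumes "left_homotopic M f g" "f \<in> hom M x y"
  obtains c i0 i1 s h where "is_cylinder M x c i0 i1 s" "h \<in> hom M c y" "h \<cdot> i0 = f" "h \<cdot> i1 = g"
  using assms unfolding left_homotopic_def by (auto simp: hom_def)

lemma right_homotopicI:
  assumes "is_path_object M y c p0 p1 s" "h \<in> hom M x c" "p0 \<cdot> h = f" "p1 \<cdot> h = g"
  shows "right_homotopic M f g"
  using model_core.left_homotopicI[OF model_core_opposite, of y c p0 p1 s h x f g] assms by simp

lemma right_homotopicE:
  assumes "right_homotopic M f g" "f \<in> hom M x y"
  obtains c p0 p1 s h where "is_path_object M y c p0 p1 s" "h \<in> hom M x c" "p0 \<cdot> h = f" "p1 \<cdot> h = g"
  by (rule model_core.left_homotopicE[OF model_core_opposite, of f g y x])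
    (use assms that in simp_all)

lemma left_homotopic_hom: "left_homotopic M f g \<Longrightarrow> f \<in> hom M x y \<longleftrightarrow> g \<in> hom M x y"
  by (auto simp: left_homotopic_def hom_def)

lemma left_homotopic_sym: "left_homotopic M f g \<Longrightarrow> left_homotopic M g f"
proof -
  assume "left_homotopic M f g"
  moreover from this have "f \<in> hom M (Dom M f) (Cod M f)" by (auto simp: left_homotopic_def hom_def)
  ultimately show ?thesis
    by (rule left_homotopicE) (rule left_homotopicI, rule cylinder_sym, assumption+)
qed

lemma left_homotopic_refl:
  assumes f: "f \<in> hom M x y"
  shows "left_homotopic M f f"
proof -
  obtain c i0 i1 s where cyl: "is_cylinder M x c i0 i1 s" using cylinder_exists hom_obj f by blast
  note cy = cylinder_hom[OF cyl]
  show ?thesis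
    using cyl cmp_hom[OF cy(3) f]
    by (rule left_homotopicI)
      (simp_all add: cmp_assoc[OF cy(1,3) f] cmp_assoc[OF cy(2,3) f] cy(5,6) cmp_idn_right[OF f])
qed

lemma left_homotopic_cmp:
  assumes "left_homotopic M f f'" "f \<in> hom M x y" "g \<in> hom M y z"
  shows "left_homotopic M (g \<cdot> f) (g \<cdot> f')"
proof -
  obtain c i0 i1 s h where cyl: "is_cylinder M x c i0 i1 s" and h: "h \<in> hom M c y" "h \<cdot> i0 = f" "h \<cdot> i1 = f'"
    using left_homotopicE[OF assms(1,2)] .
  note cy = cylinder_hom[OF cyl]
  show ?thesis
    using cyl cmp_hom[OF h(1) assms(3)]
    by (rule left_homotopicI) (simp_all add: cmp_assoc[OF cy(1) h(1) assms(3)] cmp_assoc[OF cy(2) h(1) assms(3)] h)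
qed

text \<open>Lift the constant homotopy at \<open>p \<cdot> f\<close> through \<open>p\<close>, starting at \<open>f\<close> and ending at \<open>g\<close>.\<close>
lemma trivial_fibration_monic_up_to_homotopy:
  assumes p: "p \<in> Fibr M \<inter> WEq M" "p \<in> hom M y z" and f: "f \<in> hom M x y" and g: "g \<in> hom M x y"
    and eq: "p \<cdot> f = p \<cdot> g"
  shows "left_homotopic M f g"
proof -
  obtain c i0 i1 s where cyl: "is_cylinder M x c i0 i1 s" using cylinder_exists hom_obj f by blast
  note cy = cylinder_hom[OF cyl]
  note pf = cmp_hom[OF f p(2)]
  have "p \<cdot> f = p \<cdot> f \<cdot> s \<cdot> i0" "p \<cdot> g = p \<cdot> f \<cdot> s \<cdot> i1"
    using cmp_assoc[OF cy(1,3) pf] cmp_assoc[OF cy(2,3) pf] cy(5,6) cmp_idn_right[OF pf] eq by simp_all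
  then obtain h where "h \<in> hom M c y" "h \<cdot> i0 = f" "h \<cdot> i1 = g"
    using cylinder_lift[OF cyl p f g cmp_hom[OF cy(3) pf]] by blast
  then show ?thesis using left_homotopicI[OF cyl] by blast
qed

text \<open>The common source of two standard facts. With a constant right homotopy it turns left
  homotopies into right homotopies; used with its dual, it makes homotopy transitive without
  gluing cylinders along a pushout. The left homotopy from \<open>f\<close> to \<open>g\<close> is a path of arrows that can
  be pushed along the right homotopy from \<open>g\<close> to \<open>h\<close>: the end \<open>i1\<close> of the cylinder is a trivial
  cofibration, so the right homotopy \<open>K\<close>, given on that end, extends over the whole cylinder as a
  right homotopy from the left homotopy \<open>H\<close> to the constant one at \<open>h\<close>. Its value at \<open>i0\<close> joins
  \<open>f\<close> to \<open>h\<close>.\<close>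
lemma left_right_homotopic_trans:
  assumes x: "cofibrant M x" and f: "f \<in> hom M x y"
    and fg: "left_homotopic M f g" and gh: "right_homotopic M g h"
  shows "right_homotopic M f h"
proof -
  obtain c i0 i1 s H where cyl: "is_cylinder M x c i0 i1 s" and H: "H \<in> hom M c y" "H \<cdot> i0 = f" "H \<cdot> i1 = g"
    using left_homotopicE[OF fg f] .
  have g: "g \<in> hom M x y" using left_homotopic_hom[OF fg] f by simp
  obtain d p0 p1 t K where path: "is_path_object M y d p0 p1 t"
    and K: "K \<in> hom M x d" "p0 \<cdot> K = g" "p1 \<cdot> K = h"
    using right_homotopicE[OF gh g] .
  note cy = cylinder_hom[OF cyl] and pa = path_object_hom[OF path]
  have h: "h \<in> hom M x y" using K cmp_hom[OF K(1) pa(2)] by simp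
  have hs: "h \<cdot> s \<in> hom M c y" using cmp_hom[OF cy(3) h] .
  have hsi: "h \<cdot> s \<cdot> i0 = h" "h \<cdot> s \<cdot> i1 = h"
    using cmp_assoc[OF cy(1,3) h] cmp_assoc[OF cy(2,3) h] cy(5,6) cmp_idn_right[OF h] by simp_all
  have i1: "i1 \<in> Cofib M \<inter> WEq M"
    by (rule cylinder_end_trivial_cofibration[OF x cylinder_sym[OF cyl]])
  obtain T where T: "T \<in> hom M c d" "p0 \<cdot> T = H" "p1 \<cdot> T = h \<cdot> s" "T \<cdot> i1 = K"
    using path_object_lift[OF path i1 cy(2) H(1) hs K(1)] H K hsi by metis
  show ?thesis
    using path cmp_hom[OF cy(1) T(1)]
    by (rule right_homotopicI)
      (use cmp_assoc[OF cy(1) T(1) pa(1)] cmp_assoc[OF cy(1) T(1) pa(2)] T H hsi in simp_all)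
qed

lemma right_homotopic_hom: "right_homotopic M f g \<Longrightarrow> f \<in> hom M x y \<longleftrightarrow> g \<in> hom M x y"
  by (auto simp: right_homotopic_def hom_def)

lemma right_homotopic_sym: "right_homotopic M f g \<Longrightarrow> right_homotopic M g f"
  using model_core.left_homotopic_sym[OF model_core_opposite] by simp

lemma right_homotopic_refl: "f \<in> hom M x y \<Longrightarrow> right_homotopic M f f"
  using model_core.left_homotopic_refl[OF model_core_opposite, of f y x] by simp

lemma right_homotopic_cmp:
  assumes "right_homotopic M g g'" "g \<in> hom M y z" "f \<in> hom M x y"
  shows "right_homotopic M (g \<cdot> f) (g' \<cdot> f)"
  using model_core.left_homotopic_cmp[OF model_core_opposite, of g g' z y f x] assms by simp

lemma trivial_cofibration_epic_up_to_homotopy: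
  assumes "i \<in> Cofib M \<inter> WEq M" "i \<in> hom M x y" "f \<in> hom M y z" "g \<in> hom M y z" "f \<cdot> i = g \<cdot> i"
  shows "right_homotopic M f g"
  using model_core.trivial_fibration_monic_up_to_homotopy[OF model_core_opposite, of i y x f z g] assms
  by simp

lemma right_left_homotopic_trans:
  assumes "fibrant M y" "f \<in> hom M x y" "right_homotopic M f g" "left_homotopic M g h"
  shows "left_homotopic M f h"
  using model_core.left_right_homotopic_trans[OF model_core_opposite, of y f x g h] assms by simp

lemma left_homotopic_imp_right:
  assumes "cofibrant M x" "f \<in> hom M x y" "left_homotopic M f g"
  shows "right_homotopic M f g"
  using left_right_homotopic_trans[OF assms] right_homotopic_refl left_homotopic_hom[OF assms(3)] assms(2)
  by blast

lemma right_homotopic_imp_left: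
  assumes "fibrant M y" "f \<in> hom M x y" "right_homotopic M f g"
  shows "left_homotopic M f g"
  using right_left_homotopic_trans[OF assms] left_homotopic_refl right_homotopic_hom[OF assms(3)] assms(2)
  by blast

text \<open>A homotopy on \<open>x\<close> between restrictions of \<open>f\<close> and \<open>g\<close> extends over \<open>y\<close> because the path
  object is fibred over the product of two copies of \<open>z\<close>.\<close>
lemma trivial_cofibration_extends_homotopy:
  assumes i: "i \<in> Cofib M \<inter> WEq M" "i \<in> hom M x y" and f: "f \<in> hom M y z" and g: "g \<in> hom M y z"
    and hom: "right_homotopic M (f \<cdot> i) (g \<cdot> i)"
  shows "right_homotopic M f g"
proof -
  obtain c p0 p1 s h where path: "is_path_object M z c p0 p1 s"
    and h: "h \<in> hom M x c" "p0 \<cdot> h = f \<cdot> i" "p1 \<cdot> h = g \<cdot> i"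
    using right_homotopicE[OF hom cmp_hom[OF i(2) f]] .
  obtain k where "k \<in> hom M y c" "p0 \<cdot> k = f" "p1 \<cdot> k = g"
    using path_object_lift[OF path i f g h(1)] h by metis
  then show ?thesis using right_homotopicI[OF path] by blast
qed

lemma homotopic_iff_left:
  assumes "cofibrant M x" "f \<in> hom M x y"
  shows "homotopic M f g \<longleftrightarrow> left_homotopic M f g"
  using left_homotopic_imp_right[OF assms] unfolding homotopic_def by blast

lemma homotopic_iff_right:
  assumes "fibrant M y" "f \<in> hom M x y"
  shows "homotopic M f g \<longleftrightarrow> right_homotopic M f g"
  using right_homotopic_imp_left[OF assms] unfolding homotopic_def by blast

lemma homotopic_refl: "f \<in> hom M x y \<Longrightarrow> homotopic M f f"
  using left_homotopic_refl right_homotopic_refl unfolding homotopic_def by blast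

lemma homotopic_sym: "homotopic M f g \<Longrightarrow> homotopic M g f"
  using left_homotopic_sym right_homotopic_sym unfolding homotopic_def by blast

lemma homotopic_hom: "homotopic M f g \<Longrightarrow> f \<in> hom M x y \<longleftrightarrow> g \<in> hom M x y"
  using left_homotopic_hom unfolding homotopic_def by blast

lemma homotopic_trans:
  assumes "cofibrant M x" "fibrant M y" "f \<in> hom M x y" "homotopic M f g" "homotopic M g h"
  shows "homotopic M f h"
  using assms left_right_homotopic_trans right_left_homotopic_trans unfolding homotopic_def by blast

text \<open>Left homotopies are preserved by postcomposition and right ones by precomposition, for
  arbitrary middle object; only the outer objects decide whether the two notions agree for the
  composites.\<close>
lemma homotopic_cmp:
  assumes x: "cofibrant M x" and z: "fibrant M z"
    and f: "f \<in> hom M x y" and g: "g \<in> hom M y z" and ff: "homotopic M f f'" and gg: "homotopic M g g'"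
  shows "homotopic M (g \<cdot> f) (g' \<cdot> f')"
proof -
  have f': "f' \<in> hom M x y" using homotopic_hom[OF ff] f by simp
  have "homotopic M (g \<cdot> f) (g \<cdot> f')"
    unfolding homotopic_iff_left[OF x cmp_hom[OF f g]]
    using left_homotopic_cmp[OF _ f g] ff by (simp add: homotopic_def)
  moreover have "homotopic M (g \<cdot> f') (g' \<cdot> f')"
    unfolding homotopic_iff_right[OF z cmp_hom[OF f' g]]
    using right_homotopic_cmp[OF _ g f'] gg by (simp add: homotopic_def)
  ultimately show ?thesis
    by (rule homotopic_trans[OF x z cmp_hom[OF f g]])
qed

text \<open>A retraction \<open>r\<close> of \<open>i\<close> exists because \<open>x\<close> is fibrant, and \<open>i \<cdot> r\<close> agrees with the identity
  after restriction along \<open>i\<close>, which is epic up to homotopy.\<close>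
lemma trivial_cofibration_homotopy_inverse:
  assumes i: "i \<in> Cofib M \<inter> WEq M" "i \<in> hom M x y" and x: "fibrant M x" and y: "fibrant M y"
  shows "\<exists>r \<in> hom M y x. homotopic M (r \<cdot> i) (Idn M x) \<and> homotopic M (i \<cdot> r) (Idn M y)"
proof -
  note idx = idn_hom[OF hom_obj(1)[OF i(2)]] and idy = idn_hom[OF hom_obj(2)[OF i(2)]]
  obtain r where r: "r \<in> hom M y x" "r \<cdot> i = Idn M x"
    using model_core.cofibrant_lift[OF model_core_opposite, of x i y x "Idn M x"] i x idx by auto
  have "i \<cdot> r \<cdot> i = Idn M y \<cdot> i"
    using cmp_assoc[OF i(2) r(1) i(2)] r(2) cmp_idn_left[OF i(2)] cmp_idn_right[OF i(2)] by simp
  then have "right_homotopic M (i \<cdot> r) (Idn M y)"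
    using trivial_cofibration_epic_up_to_homotopy[OF i cmp_hom[OF r(1) i(2)] idy] by simp
  then show ?thesis
    using homotopic_iff_right[OF y cmp_hom[OF r(1) i(2)]] r homotopic_refl[OF idx] by metis
qed

lemma homotopic_opposite_model [simp]: "homotopic (opposite_model M) f g \<longleftrightarrow> homotopic M f g"
  by (auto simp: homotopic_def)

lemma trivial_fibration_homotopy_inverse:
  assumes "p \<in> Fibr M \<inter> WEq M" "p \<in> hom M x y" "cofibrant M x" "cofibrant M y"
  shows "\<exists>r \<in> hom M y x. homotopic M (r \<cdot> p) (Idn M x) \<and> homotopic M (p \<cdot> r) (Idn M y)"
  using model_core.trivial_cofibration_homotopy_inverse[OF model_core_opposite, of p y x] assms
    homotopic_opposite_model by auto

section \<open>Existence of local replacements\<close>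

lemma cofibrant_replacement_exists: "\<exists>R. local_cofibrant_replacement M R"
proof -
  obtain z where z: "is_initial M z" using initial_exists by blast
  have "\<exists>c p. cofibrant M c \<and> p \<in> hom M c x \<and> p \<in> Fibr M \<inter> WEq M \<and> (cofibrant M x \<longrightarrow> c = x \<and> p = Idn M x)"
    if x: "x \<in> Obj M" for x
  proof (cases "cofibrant M x")
    case True
    then show ?thesis using idn_hom[OF x] idn_fibr[OF x] idn_weq[OF x] by blast
  next
    case False
    obtain u where "u \<in> hom M z x" using z x unfolding is_initial_def by blast
    then obtain e a b where "a \<in> hom M z e" "b \<in> hom M e x" "a \<in> Cofib M" "b \<in> Fibr M \<inter> WEq M"
      using factor_cofib by metis
    then show ?thesis using z False hom_obj unfolding cofibrant_def by blast
  qed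
  then obtain c p where cp: "\<And>x. x \<in> Obj M \<Longrightarrow> cofibrant M (c x) \<and> p x \<in> hom M (c x) x \<and>
    p x \<in> Fibr M \<inter> WEq M \<and> (cofibrant M x \<longrightarrow> c x = x \<and> p x = Idn M x)"
    by metis
  have "\<exists>g. g \<in> hom M (c (Dom M f)) (c (Cod M f)) \<and> p (Cod M f) \<cdot> g = f \<cdot> p (Dom M f)"
    if "f \<in> Arr M" for f
  proof -
    let ?x = "Dom M f" and ?y = "Cod M f"
    have x: "?x \<in> Obj M" "?y \<in> Obj M" using that dom_obj cod_obj by auto
    have "f \<cdot> p ?x \<in> hom M (c ?x) ?y" using cp[OF x(1)] arr_hom[OF that] cmp_hom by blast
    then show ?thesis using cofibrant_lift[of "c ?x" "p ?y" "c ?y" ?y "f \<cdot> p ?x"] cp[OF x(1)] cp[OF x(2)] by metis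
  qed
  then obtain g where g: "\<And>f. f \<in> Arr M \<Longrightarrow> g f \<in> hom M (c (Dom M f)) (c (Cod M f)) \<and>
    p (Cod M f) \<cdot> g f = f \<cdot> p (Dom M f)" by metis
  have "local_cofibrant_replacement M \<lparr>RepObj = c, RepMap = p, RepArr = g\<rparr>"
    unfolding local_cofibrant_replacement_def using cp g by (auto simp: hom_def)
  then show ?thesis by blast
qed

lemma fibrant_replacement_exists: "\<exists>R. local_fibrant_replacement M R"
  using model_core.cofibrant_replacement_exists[OF model_core_opposite] by simp

end

section \<open>The Kan homotopy category\<close>

context model_core
begin

abbreviation (input) bifibrant :: "'o \<Rightarrow> bool" where
  "bifibrant x \<equiv> fibrant M x \<and> cofibrant M x"

lemma homotopy_class_eq_iff:
  assumes "cofibrant M x" "fibrant M y" "f \<in> hom M x y" "g \<in> hom M x y"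
  shows "homotopy_class M f = homotopy_class M g \<longleftrightarrow> homotopic M f g"
proof
  assume "homotopy_class M f = homotopy_class M g"
  then show "homotopic M f g"
    using homotopic_refl[OF assms(4)] unfolding homotopy_class_def by blast
next
  assume fg: "homotopic M f g"
  show "homotopy_class M f = homotopy_class M g"
    unfolding homotopy_class_def
    using homotopic_trans[OF assms(1,2,3) fg] homotopic_trans[OF assms(1,2,4) homotopic_sym[OF fg]]
    by blast
qed

lemma homotopy_class_representative:
  assumes "f \<in> hom M x y"
  shows "(SOME g. g \<in> homotopy_class M f) \<in> hom M x y" "homotopic M f (SOME g. g \<in> homotopy_class M f)"
proof -
  have "f \<in> homotopy_class M f" using homotopic_refl[OF assms] by (simp add: homotopy_class_def)
  then have "(SOME g. g \<in> homotopy_class M f) \<in> homotopy_class M f" by (rule someI)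
  then show "homotopic M f (SOME g. g \<in> homotopy_class M f)" by (simp add: homotopy_class_def)
  then show "(SOME g. g \<in> homotopy_class M f) \<in> hom M x y" using homotopic_hom assms by blast
qed

lemma Obj_kan: "Obj (kan_homotopy_category M) = {x. bifibrant x}"
  by (auto simp: kan_homotopy_category_def Let_def fibrant_def)

lemma Idn_kan: "Idn (kan_homotopy_category M) x = homotopy_class M (Idn M x)"
  by (simp add: kan_homotopy_category_def Let_def)

lemma homotopy_class_in_hom_kan:
  assumes "bifibrant x" "bifibrant y" "f \<in> hom M x y"
  shows "homotopy_class M f \<in> hom (kan_homotopy_category M) x y"
  using homotopy_class_representative(1)[OF assms(3)] assms hom_obj[OF assms(3)]
  unfolding hom_def[of "kan_homotopy_category M"]
  by (auto simp: kan_homotopy_category_def Let_def hom_def[of M "Dom _ _"]) (auto simp: hom_def)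

lemma hom_kanE:
  assumes "K \<in> hom (kan_homotopy_category M) x y"
  obtains f where "f \<in> hom M x y" "K = homotopy_class M f" "bifibrant x" "bifibrant y"
proof -
  obtain x' y' f where f: "bifibrant x'" "bifibrant y'" "f \<in> hom M x' y'" "K = homotopy_class M f"
    using assms unfolding hom_def[of "kan_homotopy_category M"]
    by (auto simp: kan_homotopy_category_def Let_def)
  then have "K \<in> hom (kan_homotopy_category M) x' y'" using homotopy_class_in_hom_kan by blast
  then have "x' = x" "y' = y" using assms by (auto simp: hom_def)
  then show ?thesis using f that by blast
qed

text \<open>The composite of classes is a union over all pairs of representatives; since homotopy is a
  congruence, all members of this nonempty union are equal.\<close>
lemma Cmp_kan:
  assumes x: "cofibrant M x" and z: "fibrant M z" and f: "f \<in> hom M x y" and g: "g \<in> hom M y z"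
  shows "homotopy_class M g \<cdot>\<^bsub>kan_homotopy_category M\<^esub> homotopy_class M f = homotopy_class M (g \<cdot> f)"
proof -
  have cmp_eq: "homotopy_class M (g' \<cdot> f') = homotopy_class M (g \<cdot> f)"
    if "homotopic M f f'" "homotopic M g g'" for f' g'
  proof -
    have "f' \<in> hom M x y" "g' \<in> hom M y z" using that homotopic_hom f g by blast+
    then show ?thesis
      using homotopy_class_eq_iff[OF x z cmp_hom[OF f g]] homotopic_cmp[OF x z f g that] cmp_hom by metis
  qed
  have ne: "f \<in> homotopy_class M f" "g \<in> homotopy_class M g"
    using homotopic_refl f g unfolding homotopy_class_def by blast+
  have "(\<Union>g' \<in> homotopy_class M g. \<Union>f' \<in> homotopy_class M f. homotopy_class M (g' \<cdot> f'))
      = (\<Union>g' \<in> homotopy_class M g. \<Union>f' \<in> homotopy_class M f. homotopy_class M (g \<cdot> f))"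
    by (intro SUP_cong refl cmp_eq) (simp_all add: homotopy_class_def)
  also have "\<dots> = homotopy_class M (g \<cdot> f)"
    using ne by blast
  finally show ?thesis
    by (simp add: kan_homotopy_category_def Let_def)
qed

lemma category_kan: "category (kan_homotopy_category M)"
proof
  fix K assume "K \<in> Arr (kan_homotopy_category M)"
  then have "K \<in> hom (kan_homotopy_category M) (Dom (kan_homotopy_category M) K) (Cod (kan_homotopy_category M) K)"
    by (simp add: hom_def)
  then show "Dom (kan_homotopy_category M) K \<in> Obj (kan_homotopy_category M)"
    "Cod (kan_homotopy_category M) K \<in> Obj (kan_homotopy_category M)"
    by (auto elim: hom_kanE simp: Obj_kan)
next
  fix x assume "x \<in> Obj (kan_homotopy_category M)"
  then have x: "bifibrant x" by (simp add: Obj_kan)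
  then have "Idn M x \<in> hom M x x" by (simp add: idn_hom fibrant_def)
  then show "Idn (kan_homotopy_category M) x \<in> hom (kan_homotopy_category M) x x"
    using homotopy_class_in_hom_kan x by (simp add: Idn_kan)
next
  fix K K' x y z
  assume "K \<in> hom (kan_homotopy_category M) x y" "K' \<in> hom (kan_homotopy_category M) y z"
  then obtain f g where fg: "f \<in> hom M x y" "K = homotopy_class M f" "g \<in> hom M y z"
    "K' = homotopy_class M g" and "bifibrant x" "bifibrant z"
    by (elim hom_kanE) blast
  then show "K' \<cdot>\<^bsub>kan_homotopy_category M\<^esub> K \<in> hom (kan_homotopy_category M) x z"
    using Cmp_kan[OF _ _ fg(1,3)] homotopy_class_in_hom_kan[OF _ _ cmp_hom[OF fg(1,3)]] by simp
next
  fix K x y assume "K \<in> hom (kan_homotopy_category M) x y"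
  then obtain f where f: "f \<in> hom M x y" "K = homotopy_class M f" "bifibrant x" "bifibrant y"
    by (rule hom_kanE)
  then show "Idn (kan_homotopy_category M) y \<cdot>\<^bsub>kan_homotopy_category M\<^esub> K = K"
    "K \<cdot>\<^bsub>kan_homotopy_category M\<^esub> Idn (kan_homotopy_category M) x = K"
    using idn_hom[OF hom_obj(1)[OF f(1)]] idn_hom[OF hom_obj(2)[OF f(1)]]
      Cmp_kan[OF _ _ f(1), of y "Idn M y"] Cmp_kan[OF _ _ _ f(1), of x "Idn M x"]
    by (simp_all add: Idn_kan cmp_idn_left[OF f(1)] cmp_idn_right[OF f(1)])
next
  fix K K' K'' w x y z
  assume K: "K \<in> hom (kan_homotopy_category M) w x" and K': "K' \<in> hom (kan_homotopy_category M) x y"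
    and K'': "K'' \<in> hom (kan_homotopy_category M) y z"
  obtain f where f: "f \<in> hom M w x" "K = homotopy_class M f" "bifibrant w" "bifibrant x"
    using K by (rule hom_kanE)
  obtain g where g: "g \<in> hom M x y" "K' = homotopy_class M g" "bifibrant y"
    using K' by (rule hom_kanE)
  obtain h where h: "h \<in> hom M y z" "K'' = homotopy_class M h" "bifibrant z"
    using K'' by (rule hom_kanE)
  have "K'' \<cdot>\<^bsub>kan_homotopy_category M\<^esub> K' \<cdot>\<^bsub>kan_homotopy_category M\<^esub> K = homotopy_class M (h \<cdot> g \<cdot> f)"
    using f g h Cmp_kan[OF _ _ g(1) h(1)] Cmp_kan[OF _ _ f(1) cmp_hom[OF g(1) h(1)]] by simp
  also have "\<dots> = K'' \<cdot>\<^bsub>kan_homotopy_category M\<^esub> (K' \<cdot>\<^bsub>kan_homotopy_category M\<^esub> K)"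
    using f g h Cmp_kan[OF _ _ f(1) g(1)] Cmp_kan[OF _ _ cmp_hom[OF f(1) g(1)] h(1)]
      cmp_assoc[OF f(1) g(1) h(1)] by simp
  finally show "K'' \<cdot>\<^bsub>kan_homotopy_category M\<^esub> K' \<cdot>\<^bsub>kan_homotopy_category M\<^esub> K
    = K'' \<cdot>\<^bsub>kan_homotopy_category M\<^esub> (K' \<cdot>\<^bsub>kan_homotopy_category M\<^esub> K)" .
qed

lemma homotopy_equivalence_is_iso_kan:
  assumes "bifibrant x" "bifibrant y" "f \<in> hom M x y" "r \<in> hom M y x"
    and "homotopic M (r \<cdot> f) (Idn M x)" "homotopic M (f \<cdot> r) (Idn M y)"
  shows "is_iso (kan_homotopy_category M) (homotopy_class M f)"
proof (rule category.is_isoI[OF category_kan])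
  note idx = idn_hom[OF hom_obj(1)[OF assms(3)]] and idy = idn_hom[OF hom_obj(2)[OF assms(3)]]
  show "homotopy_class M f \<in> hom (kan_homotopy_category M) x y"
    "homotopy_class M r \<in> hom (kan_homotopy_category M) y x"
    using assms homotopy_class_in_hom_kan by blast+
  show "homotopy_class M r \<cdot>\<^bsub>kan_homotopy_category M\<^esub> homotopy_class M f = Idn (kan_homotopy_category M) x"
    using assms homotopy_class_eq_iff[OF _ _ cmp_hom[OF assms(3,4)] idx] by (simp add: Cmp_kan[OF _ _ assms(3,4)] Idn_kan)
  show "homotopy_class M f \<cdot>\<^bsub>kan_homotopy_category M\<^esub> homotopy_class M r = Idn (kan_homotopy_category M) y"
    using assms homotopy_class_eq_iff[OF _ _ cmp_hom[OF assms(4,3)] idy] by (simp add: Cmp_kan[OF _ _ assms(4,3)] Idn_kan)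
qed

lemma fibrant_source: "fibrant M y \<Longrightarrow> p \<in> hom M x y \<Longrightarrow> p \<in> Fibr M \<Longrightarrow> fibrant M x"
  using model_core.cofibrant_target[OF model_core_opposite, of y p x] by simp

text \<open>Whitehead's theorem. The middle object of the factorization is cofibrant through the
  trivial cofibration and fibrant through the fibration.\<close>
lemma weq_is_iso_kan:
  assumes x: "bifibrant x" and y: "bifibrant y" and w: "w \<in> hom M x y" "w \<in> WEq M"
  shows "is_iso (kan_homotopy_category M) (homotopy_class M w)"
proof -
  obtain z i p where i: "i \<in> hom M x z" "i \<in> Cofib M \<inter> WEq M" and p: "p \<in> hom M z y" "p \<in> Fibr M"
    and pi: "p \<cdot> i = w"
    using factor_fibr[OF w(1)] by blast
  have pw: "p \<in> Fibr M \<inter> WEq M" using weq_cancel_right[OF i(1) p(1)] i p w pi by simp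
  have z: "bifibrant z" using cofibrant_target[OF _ i(1)] fibrant_source[OF _ p] x y i by blast
  obtain r where "r \<in> hom M z x" "homotopic M (r \<cdot> i) (Idn M x)" "homotopic M (i \<cdot> r) (Idn M z)"
    using trivial_cofibration_homotopy_inverse[OF i(2,1)] x z by blast
  then have "is_iso (kan_homotopy_category M) (homotopy_class M i)"
    using homotopy_equivalence_is_iso_kan[OF x z i(1)] by blast
  moreover obtain q where "q \<in> hom M y z" "homotopic M (q \<cdot> p) (Idn M z)" "homotopic M (p \<cdot> q) (Idn M y)"
    using trivial_fibration_homotopy_inverse[OF pw p(1)] y z by blast
  then have "is_iso (kan_homotopy_category M) (homotopy_class M p)"
    using homotopy_equivalence_is_iso_kan[OF z y p(1)] by blast
  ultimately have "is_iso (kan_homotopy_category M)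
      (homotopy_class M p \<cdot>\<^bsub>kan_homotopy_category M\<^esub> homotopy_class M i)"
    by (intro category.is_iso_cmp[OF category_kan homotopy_class_in_hom_kan[OF x z i(1)] _
          homotopy_class_in_hom_kan[OF z y p(1)]])
  then show ?thesis using Cmp_kan[OF _ _ i(1) p(1)] x y pi by simp
qed

text \<open>The two ends of a cylinder are sections of the weak equivalence \<open>s\<close>, whose image is
  cancellable, so they have equal images.\<close>
lemma inverting_functor_identifies_homotopic:
  assumes G: "inverts M D (WEq M) G" and fg: "left_homotopic M f g"
  shows "ArrMap G f = ArrMap G g"
proof -
  interpret G: cat_functor M D G using G by (simp add: inverts_def)
  have "f \<in> hom M (Dom M f) (Cod M f)" using fg by (auto simp: left_homotopic_def hom_def)
  then obtain c i0 i1 s h where cyl: "is_cylinder M (Dom M f) c i0 i1 s"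
    and h: "h \<in> hom M c (Cod M f)" "h \<cdot> i0 = f" "h \<cdot> i1 = g"
    using left_homotopicE[OF fg] by blast
  note cy = cylinder_hom[OF cyl]
  have "is_iso D (ArrMap G s)" using G cy(7) by (simp add: inverts_def)
  moreover have "ArrMap G s \<cdot>\<^bsub>D\<^esub> ArrMap G i0 = ArrMap G s \<cdot>\<^bsub>D\<^esub> ArrMap G i1"
    using G.map_cmp[OF cy(1,3)] G.map_cmp[OF cy(2,3)] cy(5,6) by simp
  ultimately have "ArrMap G i0 = ArrMap G i1"
    using G.B.iso_cancel_left[OF _ G.arr_map[OF cy(3)] G.arr_map[OF cy(1)] G.arr_map[OF cy(2)]] by blast
  then show ?thesis using G.map_cmp[OF cy(1) h(1)] G.map_cmp[OF cy(2) h(1)] h(2,3) by simp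
qed

text \<open>The choice of representatives is harmless for functors that invert weak equivalences, as
  these are constant on homotopy classes.\<close>
definition descend :: "('o, 'm, 'p, 'n) cat_map \<Rightarrow> ('o, 'm set, 'p, 'n) cat_map" where
  "descend G = \<lparr>ObjMap = ObjMap G, ArrMap = (\<lambda>K. ArrMap G (SOME f. f \<in> K))\<rparr>"

lemma descend_homotopy_class:
  assumes "inverts M D (WEq M) G" "f \<in> hom M x y"
  shows "ArrMap (descend G) (homotopy_class M f) = ArrMap G f"
proof -
  have "left_homotopic M f (SOME g. g \<in> homotopy_class M f)"
    using homotopy_class_representative(2)[OF assms(2)] by (simp add: homotopic_def)
  from inverting_functor_identifies_homotopic[OF assms(1) this] show ?thesis
    by (simp add: descend_def)
qed

lemma cat_functor_descend:
  assumes G: "inverts M D (WEq M) G"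
  shows "cat_functor (kan_homotopy_category M) D (descend G)"
proof -
  interpret G: cat_functor M D G using G by (simp add: inverts_def)
  interpret H: category "kan_homotopy_category M" by (rule category_kan)
  have obj: "ObjMap (descend G) x = ObjMap G x" for x by (simp add: descend_def)
  show ?thesis
  proof
    fix x assume "x \<in> Obj (kan_homotopy_category M)"
    then have x: "x \<in> Obj M" by (simp add: Obj_kan fibrant_def)
    then show "ObjMap (descend G) x \<in> Obj D" by (simp add: obj G.obj_map)
    show "ArrMap (descend G) (Idn (kan_homotopy_category M) x) = Idn D (ObjMap (descend G) x)"
      using x by (simp add: obj Idn_kan descend_homotopy_class[OF G idn_hom] G.map_idn)
  next
    fix K x y assume "K \<in> hom (kan_homotopy_category M) x y"
    then obtain f where "f \<in> hom M x y" "K = homotopy_class M f" by (rule hom_kanE)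
    then show "ArrMap (descend G) K \<in> hom D (ObjMap (descend G) x) (ObjMap (descend G) y)"
      by (simp add: obj descend_homotopy_class[OF G] G.arr_map)
  next
    fix K x y K' z
    assume "K \<in> hom (kan_homotopy_category M) x y" "K' \<in> hom (kan_homotopy_category M) y z"
    then obtain f g where fg: "f \<in> hom M x y" "K = homotopy_class M f" "g \<in> hom M y z"
      "K' = homotopy_class M g" and "bifibrant x" "bifibrant z"
      by (elim hom_kanE) blast
    then have "K' \<cdot>\<^bsub>kan_homotopy_category M\<^esub> K = homotopy_class M (g \<cdot> f)"
      using Cmp_kan[OF _ _ fg(1,3)] by simp
    then show "ArrMap (descend G) (K' \<cdot>\<^bsub>kan_homotopy_category M\<^esub> K)
      = ArrMap (descend G) K' \<cdot>\<^bsub>D\<^esub> ArrMap (descend G) K"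
      using G.map_cmp[OF fg(1,3)]
      by (simp add: fg(2,4) descend_homotopy_class[OF G fg(1)] descend_homotopy_class[OF G fg(3)]
          descend_homotopy_class[OF G cmp_hom[OF fg(1,3)]])
  qed
qed

end

section \<open>The localization functor\<close>

locale local_replacements = model_core +
  fixes Ct Ft :: "('a, 'b) replacement"
  assumes cofibrant_replacement: "local_cofibrant_replacement M Ct"
    and fibrant_replacement: "local_fibrant_replacement M Ft"
begin

abbreviation (input) cofrep :: "'a \<Rightarrow> 'a" where "cofrep x \<equiv> RepObj Ct x"
abbreviation (input) birep :: "'a \<Rightarrow> 'a" where "birep x \<equiv> RepObj Ft (cofrep x)"
abbreviation (input) to_obj :: "'a \<Rightarrow> 'b" where "to_obj x \<equiv> RepMap Ct x"
abbreviation (input) to_birep :: "'a \<Rightarrow> 'b" where "to_birep x \<equiv> RepMap Ft (cofrep x)"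

lemma cofrep:
  assumes "x \<in> Obj M"
  shows "cofibrant M (cofrep x)" "cofrep x \<in> Obj M" "to_obj x \<in> hom M (cofrep x) x"
    "to_obj x \<in> Fibr M \<inter> WEq M"
  using cofibrant_replacement assms unfolding local_cofibrant_replacement_def by (auto simp: cofibrant_def)

lemma birep:
  assumes "x \<in> Obj M"
  shows "fibrant M (birep x)" "cofibrant M (birep x)" "birep x \<in> Obj M"
    "to_birep x \<in> hom M (cofrep x) (birep x)" "to_birep x \<in> Cofib M \<inter> WEq M"
proof -
  show *: "fibrant M (birep x)" "to_birep x \<in> hom M (cofrep x) (birep x)" "to_birep x \<in> Cofib M \<inter> WEq M"
    using fibrant_replacement cofrep(2)[OF assms] unfolding local_fibrant_replacement_def by auto
  then show "birep x \<in> Obj M" by (simp add: fibrant_def)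
  show "cofibrant M (birep x)" using cofibrant_target[OF cofrep(1)[OF assms] *(2)] * by blast
qed

lemma cofrep_cofibrant: "cofibrant M x \<Longrightarrow> cofrep x = x \<and> to_obj x = Idn M x"
  using cofibrant_replacement unfolding local_cofibrant_replacement_def by (auto simp: cofibrant_def)

lemma fibrep_fibrant: "fibrant M x \<Longrightarrow> RepObj Ft x = x \<and> RepMap Ft x = Idn M x"
  using fibrant_replacement unfolding local_fibrant_replacement_def by (auto simp: fibrant_def)

text \<open>The ladder between the zigzags of \<open>x\<close> and \<open>y\<close>, with an unspecified middle rung. The middle
  rung is left open so that identities, composites and the legs of the zigzag themselves have
  evident bifibrant lifts.\<close>
definition bifibrant_lift :: "'a \<Rightarrow> 'a \<Rightarrow> 'b \<Rightarrow> 'b \<Rightarrow> bool" where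
  "bifibrant_lift x y f h \<longleftrightarrow> h \<in> hom M (birep x) (birep y) \<and>
    (\<exists>h' \<in> hom M (cofrep x) (cofrep y).
      to_obj y \<cdot> h' = f \<cdot> to_obj x \<and> h \<cdot> to_birep x = to_birep y \<cdot> h')"

lemma bifibrant_lift_RepArr:
  assumes f: "f \<in> hom M x y"
  shows "bifibrant_lift x y f (RepArr Ft (RepArr Ct f))"
    "RepArr Ct f \<in> hom M (cofrep x) (cofrep y)" "to_obj y \<cdot> RepArr Ct f = f \<cdot> to_obj x"
    "RepArr Ft (RepArr Ct f) \<cdot> to_birep x = to_birep y \<cdot> RepArr Ct f"
    "RepArr Ft (RepArr Ct f) \<in> hom M (birep x) (birep y)"
proof -
  show 1: "RepArr Ct f \<in> hom M (cofrep x) (cofrep y)" "to_obj y \<cdot> RepArr Ct f = f \<cdot> to_obj x"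
    using f cofibrant_replacement unfolding local_cofibrant_replacement_def by blast+
  then show 2: "RepArr Ft (RepArr Ct f) \<cdot> to_birep x = to_birep y \<cdot> RepArr Ct f"
    "RepArr Ft (RepArr Ct f) \<in> hom M (birep x) (birep y)"
    using fibrant_replacement unfolding local_fibrant_replacement_def by blast+
  show "bifibrant_lift x y f (RepArr Ft (RepArr Ct f))"
    unfolding bifibrant_lift_def using 1 2 by blast
qed

text \<open>The middle rungs agree after composition with the trivial fibration to \<open>y\<close>, hence are left
  homotopic. On passing to the fibrant object \<open>birep y\<close> this becomes a right homotopy, which
  extends along the trivial cofibration out of \<open>cofrep x\<close>.\<close>
lemma bifibrant_lift_unique:
  assumes f: "f \<in> hom M x y" and h: "bifibrant_lift x y f h" and k: "bifibrant_lift x y f k"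
  shows "homotopic M h k"
proof -
  note x = cofrep[OF hom_obj(1)[OF f]] birep[OF hom_obj(1)[OF f]]
    and y = cofrep[OF hom_obj(2)[OF f]] birep[OF hom_obj(2)[OF f]]
  obtain h' where h': "h' \<in> hom M (cofrep x) (cofrep y)" "to_obj y \<cdot> h' = f \<cdot> to_obj x"
    "h \<cdot> to_birep x = to_birep y \<cdot> h'" and hh: "h \<in> hom M (birep x) (birep y)"
    using h by (auto simp: bifibrant_lift_def)
  obtain k' where k': "k' \<in> hom M (cofrep x) (cofrep y)" "to_obj y \<cdot> k' = f \<cdot> to_obj x"
    "k \<cdot> to_birep x = to_birep y \<cdot> k'" and kh: "k \<in> hom M (birep x) (birep y)"
    using k by (auto simp: bifibrant_lift_def)
  have "left_homotopic M h' k'"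
    using trivial_fibration_monic_up_to_homotopy[OF y(4,3) h'(1) k'(1)] h' k' by simp
  then have "left_homotopic M (h \<cdot> to_birep x) (k \<cdot> to_birep x)"
    using left_homotopic_cmp[OF _ h'(1) y(8)] h' k' by simp
  then have "right_homotopic M (h \<cdot> to_birep x) (k \<cdot> to_birep x)"
    by (rule left_homotopic_imp_right[OF x(1) cmp_hom[OF x(8) hh]])
  then have "right_homotopic M h k"
    by (rule trivial_cofibration_extends_homotopy[OF x(9,8) hh kh])
  then show ?thesis using homotopic_iff_right[OF y(5) hh] by simp
qed

lemma bifibrant_lift_idn:
  assumes "x \<in> Obj M"
  shows "bifibrant_lift x x (Idn M x) (Idn M (birep x))"
  using idn_hom[OF birep(3)[OF assms]] idn_hom[OF cofrep(2)[OF assms]]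
    cmp_idn_left[OF cofrep(3)[OF assms]] cmp_idn_right[OF cofrep(3)[OF assms]]
    cmp_idn_left[OF birep(4)[OF assms]] cmp_idn_right[OF birep(4)[OF assms]]
  unfolding bifibrant_lift_def by auto

lemma bifibrant_lift_cmp:
  assumes f: "f \<in> hom M x y" and g: "g \<in> hom M y z"
    and h: "bifibrant_lift x y f h" and k: "bifibrant_lift y z g k"
  shows "bifibrant_lift x z (g \<cdot> f) (k \<cdot> h)"
proof -
  note x = cofrep[OF hom_obj(1)[OF f]] birep[OF hom_obj(1)[OF f]]
    and y = cofrep[OF hom_obj(2)[OF f]] birep[OF hom_obj(2)[OF f]]
    and z = cofrep[OF hom_obj(2)[OF g]] birep[OF hom_obj(2)[OF g]]
  obtain h' where h': "h' \<in> hom M (cofrep x) (cofrep y)" "to_obj y \<cdot> h' = f \<cdot> to_obj x"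
    "h \<cdot> to_birep x = to_birep y \<cdot> h'" and hh: "h \<in> hom M (birep x) (birep y)"
    using h by (auto simp: bifibrant_lift_def)
  obtain k' where k': "k' \<in> hom M (cofrep y) (cofrep z)" "to_obj z \<cdot> k' = g \<cdot> to_obj y"
    "k \<cdot> to_birep y = to_birep z \<cdot> k'" and kh: "k \<in> hom M (birep y) (birep z)"
    using k by (auto simp: bifibrant_lift_def)
  have "to_obj z \<cdot> (k' \<cdot> h') = g \<cdot> f \<cdot> to_obj x"
    using cmp_assoc[OF h'(1) k'(1) z(3)] cmp_assoc[OF h'(1) y(3) g] cmp_assoc[OF x(3) f g] h' k' by simp
  moreover have "k \<cdot> h \<cdot> to_birep x = to_birep z \<cdot> (k' \<cdot> h')"
    using cmp_assoc[OF h'(1) k'(1) z(8)] cmp_assoc[OF h'(1) y(8) kh] cmp_assoc[OF x(8) hh kh] h' k' by simp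
  ultimately show ?thesis
    unfolding bifibrant_lift_def using cmp_hom[OF hh kh] cmp_hom[OF h'(1) k'(1)] by blast
qed

lemma localization_functor_ArrMap:
  assumes "f \<in> hom M x y" "bifibrant_lift x y f h"
  shows "ArrMap (localization_functor M Ft Ct) f = homotopy_class M h"
  using bifibrant_lift_unique[OF assms(1) bifibrant_lift_RepArr(1)[OF assms(1)] assms(2)]
    homotopy_class_eq_iff[OF birep(2)[OF hom_obj(1)] birep(1)[OF hom_obj(2)], OF assms(1) assms(1)]
    assms(2) bifibrant_lift_RepArr(5)[OF assms(1)]
  by (simp add: localization_functor_def bifibrant_lift_def)

lemma localization_functor_ObjMap: "ObjMap (localization_functor M Ft Ct) x = birep x"
  by (simp add: localization_functor_def)

lemma cat_functor_localization_functor: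
  "cat_functor M (kan_homotopy_category M) (localization_functor M Ft Ct)"
proof -
  interpret H: category "kan_homotopy_category M" by (rule category_kan)
  show ?thesis
  proof
    fix x assume x: "x \<in> Obj M"
    show "ObjMap (localization_functor M Ft Ct) x \<in> Obj (kan_homotopy_category M)"
      using birep[OF x] by (simp add: localization_functor_ObjMap Obj_kan)
    show "ArrMap (localization_functor M Ft Ct) (Idn M x)
      = Idn (kan_homotopy_category M) (ObjMap (localization_functor M Ft Ct) x)"
      using localization_functor_ArrMap[OF idn_hom[OF x] bifibrant_lift_idn[OF x]]
      by (simp add: localization_functor_ObjMap Idn_kan)
  next
    fix f x y assume f: "f \<in> hom M x y"
    show "ArrMap (localization_functor M Ft Ct) f \<in> hom (kan_homotopy_category M)
      (ObjMap (localization_functor M Ft Ct) x) (ObjMap (localization_functor M Ft Ct) y)"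
      using localization_functor_ArrMap[OF f bifibrant_lift_RepArr(1)[OF f]]
        homotopy_class_in_hom_kan[OF _ _ bifibrant_lift_RepArr(5)[OF f]]
        birep[OF hom_obj(1)[OF f]] birep[OF hom_obj(2)[OF f]]
      by (simp add: localization_functor_ObjMap)
  next
    fix f x y g z assume f: "f \<in> hom M x y" and g: "g \<in> hom M y z"
    note lf = bifibrant_lift_RepArr[OF f] and lg = bifibrant_lift_RepArr[OF g]
    show "ArrMap (localization_functor M Ft Ct) (g \<cdot> f)
      = ArrMap (localization_functor M Ft Ct) g \<cdot>\<^bsub>kan_homotopy_category M\<^esub> ArrMap (localization_functor M Ft Ct) f"
      using localization_functor_ArrMap[OF f lf(1)] localization_functor_ArrMap[OF g lg(1)]
        localization_functor_ArrMap[OF cmp_hom[OF f g] bifibrant_lift_cmp[OF f g lf(1) lg(1)]]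
        Cmp_kan[OF _ _ lf(5) lg(5)] birep[OF hom_obj(1)[OF f]] birep[OF hom_obj(2)[OF g]]
      by simp
  qed
qed

text \<open>The two-out-of-three property carries a weak equivalence along both squares of the ladder;
  Whitehead's theorem does the rest.\<close>
lemma inverts_localization_functor:
  "inverts M (kan_homotopy_category M) (WEq M) (localization_functor M Ft Ct)"
  unfolding inverts_def
proof (intro conjI ballI cat_functor_localization_functor)
  fix w assume w: "w \<in> WEq M"
  let ?x = "Dom M w" and ?y = "Cod M w"
  have wh: "w \<in> hom M ?x ?y" using w weq_arr by (auto simp: hom_def)
  note x = cofrep[OF hom_obj(1)[OF wh]] birep[OF hom_obj(1)[OF wh]]
    and y = cofrep[OF hom_obj(2)[OF wh]] birep[OF hom_obj(2)[OF wh]]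
  note l = bifibrant_lift_RepArr[OF wh]
  have "RepArr Ct w \<in> WEq M"
    using weq_cancel_left[OF l(2) y(3)] weq_cmp[OF x(3) wh] x(4) y(4) w l(3) by simp
  then have "RepArr Ft (RepArr Ct w) \<in> WEq M"
    using weq_cancel_right[OF x(8) l(5)] weq_cmp[OF l(2) y(8)] x(9) y(9) l(4) by simp
  then show "is_iso (kan_homotopy_category M) (ArrMap (localization_functor M Ft Ct) w)"
    using weq_is_iso_kan[OF _ _ l(5)] x y localization_functor_ArrMap[OF wh l(1)] by simp
qed

text \<open>The components of the comparison are \<open>G\<close> applied to the zigzag, with the leg pointing
  backwards inverted; naturality is \<open>G\<close> applied to the two squares of the ladder.\<close>
lemma localization_functor_universal:
  assumes G: "inverts M D (WEq M) G"
  shows "\<exists>\<eta>. nat_iso M D G (cat_comp M (descend G) (localization_functor M Ft Ct)) \<eta>"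
proof -
  interpret G: cat_functor M D G using G by (simp add: inverts_def)
  have iso: "is_iso D (ArrMap G w)" if "w \<in> WEq M" for w using that G by (simp add: inverts_def)
  let ?L = "localization_functor M Ft Ct"
  have "\<exists>e. e \<in> hom D (ObjMap G x) (ObjMap G (cofrep x)) \<and>
      e \<cdot>\<^bsub>D\<^esub> ArrMap G (to_obj x) = Idn D (ObjMap G (cofrep x)) \<and>
      ArrMap G (to_obj x) \<cdot>\<^bsub>D\<^esub> e = Idn D (ObjMap G x)" if "x \<in> Obj M" for x
    using G.B.is_isoE[OF iso G.arr_map[OF cofrep(3)[OF that]]] cofrep(4)[OF that] by blast
  then obtain e where e: "\<And>x. x \<in> Obj M \<Longrightarrow> e x \<in> hom D (ObjMap G x) (ObjMap G (cofrep x))"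
    "\<And>x. x \<in> Obj M \<Longrightarrow> e x \<cdot>\<^bsub>D\<^esub> ArrMap G (to_obj x) = Idn D (ObjMap G (cofrep x))"
    "\<And>x. x \<in> Obj M \<Longrightarrow> ArrMap G (to_obj x) \<cdot>\<^bsub>D\<^esub> e x = Idn D (ObjMap G x)"
    by metis
  define \<eta> where "\<eta> x = ArrMap G (to_birep x) \<cdot>\<^bsub>D\<^esub> e x" for x
  have \<eta>_hom: "\<eta> x \<in> hom D (ObjMap G x) (ObjMap G (birep x))" if "x \<in> Obj M" for x
    unfolding \<eta>_def using G.B.cmp_hom[OF e(1)[OF that] G.arr_map[OF birep(4)[OF that]]] .
  have \<eta>_iso: "is_iso D (\<eta> x)" if x: "x \<in> Obj M" for x
  proof -
    have "is_iso D (e x)"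
      using G.B.is_isoI[OF e(1)[OF x] G.arr_map[OF cofrep(3)[OF x]]] e(2,3)[OF x] by blast
    moreover have "is_iso D (ArrMap G (to_birep x))" using iso birep(5)[OF x] by blast
    ultimately show ?thesis
      unfolding \<eta>_def using G.B.is_iso_cmp[OF e(1)[OF x] _ G.arr_map[OF birep(4)[OF x]]] by blast
  qed
  have \<eta>_nat: "\<eta> y \<cdot>\<^bsub>D\<^esub> ArrMap G f = ArrMap (descend G) (ArrMap ?L f) \<cdot>\<^bsub>D\<^esub> \<eta> x"
    if f: "f \<in> hom M x y" for f x y
  proof -
    note x = hom_obj(1)[OF f] and y = hom_obj(2)[OF f]
    define h' h where "h' = RepArr Ct f" and "h = RepArr Ft h'"
    note l = bifibrant_lift_RepArr[OF f, folded h'_def, folded h_def]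
    note cx = cofrep(3)[OF x] and cy = cofrep(3)[OF y] and jx = birep(4)[OF x] and jy = birep(4)[OF y]
    note Gm = G.arr_map[OF f] G.arr_map[OF l(2)] G.arr_map[OF cx] G.arr_map[OF cy]
      G.arr_map[OF jx] G.arr_map[OF jy] G.arr_map[OF l(5)]
    \<comment> \<open>The left square of the ladder points against \<open>e\<close>, so it is checked after composing with the invertible \<open>G (to_obj y)\<close>.\<close>
    have "ArrMap G (to_obj y) \<cdot>\<^bsub>D\<^esub> (e y \<cdot>\<^bsub>D\<^esub> ArrMap G f) = ArrMap G f"
      using G.B.cmp_assoc[OF Gm(1) e(1)[OF y] Gm(4)] e(3)[OF y] G.B.cmp_idn_left[OF Gm(1)] by simp
    moreover have "ArrMap G (to_obj y) \<cdot>\<^bsub>D\<^esub> (ArrMap G h' \<cdot>\<^bsub>D\<^esub> e x) = ArrMap G f"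
      using G.B.cmp_assoc[OF e(1)[OF x] Gm(2,4)] G.B.cmp_assoc[OF e(1)[OF x] Gm(3,1)] e(3)[OF x]
        G.B.cmp_idn_right[OF Gm(1)] G.map_cmp[OF l(2) cy] G.map_cmp[OF cx f] l(3) by simp
    moreover have "is_iso D (ArrMap G (to_obj y))" using iso cofrep(4)[OF y] by blast
    ultimately
    have eq: "e y \<cdot>\<^bsub>D\<^esub> ArrMap G f = ArrMap G h' \<cdot>\<^bsub>D\<^esub> e x"
      using G.B.iso_cancel_left[OF _ Gm(4) G.B.cmp_hom[OF Gm(1) e(1)[OF y]] G.B.cmp_hom[OF e(1)[OF x] Gm(2)]]
      by metis
    have "ArrMap (descend G) (ArrMap ?L f) = ArrMap G h"
      using localization_functor_ArrMap[OF f l(1)] descend_homotopy_class[OF G l(5)] by simp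
    then show ?thesis
      unfolding \<eta>_def
      using G.B.cmp_assoc[OF Gm(1) e(1)[OF y] Gm(6)] G.B.cmp_assoc[OF e(1)[OF x] Gm(2,6)]
        G.B.cmp_assoc[OF e(1)[OF x] Gm(5,7)] G.map_cmp[OF jx l(5)] G.map_cmp[OF l(2) jy] l(4) eq
      by simp
  qed
  have "nat_iso M D G (cat_comp M (descend G) ?L) \<eta>"
    unfolding nat_iso_def nat_trans_def
    using G.cat_functor_axioms cat_functor_cat_comp[OF cat_functor_localization_functor cat_functor_descend[OF G]]
      \<eta>_hom \<eta>_iso \<eta>_nat[OF arr_hom]
    by (simp add: cat_comp_ObjMap cat_comp_ArrMap localization_functor_ObjMap) (simp add: descend_def)
  then show ?thesis by blast
qed

lemma localization_functor_bifibrant: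
  assumes f: "f \<in> hom M x y" and x: "bifibrant x" and y: "bifibrant y"
  shows "ArrMap (localization_functor M Ft Ct) f = homotopy_class M f"
proof (rule localization_functor_ArrMap[OF f])
  show "bifibrant_lift x y f f"
    using f x y by (auto simp: bifibrant_lift_def cofrep_cofibrant fibrep_fibrant
        cmp_idn_left[OF f] cmp_idn_right[OF f] intro!: bexI[of _ f])
qed

text \<open>As \<open>cofrep x\<close> is its own cofibrant replacement, the identity is a bifibrant lift of the leg
  of the zigzag.\<close>
lemma localization_functor_to_obj:
  assumes x: "x \<in> Obj M"
  shows "ArrMap (localization_functor M Ft Ct) (to_obj x) = Idn (kan_homotopy_category M) (birep x)"
proof -
  note cx = cofrep[OF x] and bx = birep[OF x]
  have "bifibrant_lift (cofrep x) x (to_obj x) (Idn M (birep x))"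
    using idn_hom[OF bx(3)] idn_hom[OF cx(2)] cmp_idn_left[OF bx(4)] cmp_idn_right[OF bx(4)]
    by (auto simp: bifibrant_lift_def cofrep_cofibrant[OF cx(1)])
  then show ?thesis using localization_functor_ArrMap[OF cx(3)] by (simp add: Idn_kan)
qed

lemma localization_functor_to_birep:
  assumes x: "x \<in> Obj M"
  shows "ArrMap (localization_functor M Ft Ct) (to_birep x) = Idn (kan_homotopy_category M) (birep x)"
proof -
  note cx = cofrep[OF x] and bx = birep[OF x]
  have "bifibrant_lift (cofrep x) (birep x) (to_birep x) (Idn M (birep x))"
    using idn_hom[OF bx(3)] idn_hom[OF cx(2)] cmp_idn_left[OF bx(4)] cmp_idn_right[OF bx(4)] bx(4)
    by (auto simp: bifibrant_lift_def cofrep_cofibrant[OF cx(1)] cofrep_cofibrant[OF bx(2)]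
        fibrep_fibrant[OF bx(1)])
  then show ?thesis using localization_functor_ArrMap[OF bx(4)] by (simp add: Idn_kan)
qed

lemma weak_localization_localization_functor:
  "weak_localization (T :: ('e \<times> 'f) itself) M (WEq M) (kan_homotopy_category M) (localization_functor M Ft Ct)"
  unfolding weak_localization_def
proof (intro conjI allI impI)
  let ?H = "kan_homotopy_category M" and ?L = "localization_functor M Ft Ct"
  show "inverts M ?H (WEq M) ?L" by (rule inverts_localization_functor)
  fix D :: "('e, 'f) category" assume D: "category D"
  show "\<exists>F' \<eta>. cat_functor ?H D F' \<and> nat_iso M D G (cat_comp M F' ?L) \<eta>"
    if "inverts M D (WEq M) G" for G
    using cat_functor_descend[OF that] localization_functor_universal[OF that] by blast
  show "fully_faithful (functor_category ?H D) (functor_category M D) (precomposition M ?L)"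
  proof (rule precomposition_fully_faithful[where S = "\<lambda>z. z", OF cat_functor_localization_functor D])
    fix z assume "z \<in> Obj ?H"
    then have "bifibrant z" by (simp add: Obj_kan)
    then show "z \<in> Obj M \<and> ObjMap ?L z = z"
      using cofrep_cofibrant fibrep_fibrant by (simp add: localization_functor_ObjMap fibrant_def)
  next
    fix z z' K assume "K \<in> hom ?H z z'"
    then show "\<exists>f\<in>hom M z z'. ArrMap ?L f = K"
      by (elim hom_kanE) (use localization_functor_bifibrant in blast)
  next
    fix x assume x: "x \<in> Obj M"
    show "\<exists>v. \<exists>a\<in>hom M v x. \<exists>b\<in>hom M v (ObjMap ?L x).
      ArrMap ?L a = Idn ?H (ObjMap ?L x) \<and> ArrMap ?L b = Idn ?H (ObjMap ?L x)"
      unfolding localization_functor_ObjMap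
      using localization_functor_to_obj[OF x] localization_functor_to_birep[OF x] cofrep(3)[OF x] birep(4)[OF x]
      by blast
  qed
qed

end

theorem theorem1:
  fixes M :: "('o, 'm) model_structure"
  assumes "model_category M"
  shows "(\<exists>Ct. local_cofibrant_replacement M Ct) \<and>
    (\<exists>Ft. local_fibrant_replacement M Ft) \<and>
    (\<forall>Ct Ft. local_cofibrant_replacement M Ct \<longrightarrow> local_fibrant_replacement M Ft \<longrightarrow>
      weak_localization TYPE('q \<times> 'k) M (WEq M)
        (kan_homotopy_category M) (localization_functor M Ft Ct))"
proof -
  interpret model_category M by fact
  interpret core: model_core M by (rule model_core)
  show ?thesis
  proof (intro conjI allI impI)
    show "\<exists>Ct. local_cofibrant_replacement M Ct" by (rule core.cofibrant_replacement_exists)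
    show "\<exists>Ft. local_fibrant_replacement M Ft" by (rule core.fibrant_replacement_exists)
    fix Ct Ft assume "local_cofibrant_replacement M Ct" "local_fibrant_replacement M Ft"
    then interpret local_replacements M Ct Ft by unfold_locales
    show "weak_localization TYPE('q \<times> 'k) M (WEq M)
        (kan_homotopy_category M) (localization_functor M Ft Ct)"
      by (rule weak_localization_localization_functor)
  qed
qed

end
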